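(* Let $\nu=\nu_1=\cdots=\nu_n$ have bounded support in $B_Y(0,R)$, let $F=(F_1,\dots,F_n)$ be an i.i.d. vector of random functionals, $F_i=F_i(\omega_i)$, and let $\beta=\beta_1=\cdots=\beta_n$ where $$\beta_i=\sup_{y\in Y,\,y\ne0,\ \omega\in\Omega^X}\frac{|D_yF_i(\omega)|}{|y|_Y}.$$ Then, for all $x>0$, $$P\big(|F|_2\ge x+2E[|F|_2]\big)\le\exp\left(\frac x{\beta R}-\left(\frac x{\beta R}+\frac{\tilde\alpha_R^2}{\beta^2R^2}\right)\log\left(1+\frac{x\beta R}{\tilde\alpha_R^2}\right)\right),$$ where $$\tilde\alpha_R^2=\left(8\beta^2+\frac{2\beta^4R^2}{(E[|F_1|])^2}\right)\int_Y|y|_Y^2\,\nu(dy).$$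
   Context: $Y$ is a normed linear space with norm $|\cdot|_Y$ and $B_Y(0,R)=\{y\in Y:|y|_Y\le R\}$; $\nu_1,\dots,\nu_n$ are diffuse Radon measures on $Y$, $X=\{1,\dots,n\}\times Y$ with intensity $d\nu_i(y)$ on $\{i\}\times Y$. $\Omega^X\simeq\Omega^Y\times\cdots\times\Omega^Y$, $\omega=(\omega_1,\dots,\omega_n)$, is the configuration space, and under $P$ the $\omega_i$ are independent Poisson configurations on $Y$ with intensities $\nu_i$. Each $F_i$ depends only on $\omega_i$, and $D_yF_i(\omega)=F_i(\omega_i\cup\{y\})-F_i(\omega_i)$. $|\cdot|_2$ is the Euclidean norm on $\mathbb R^n$. *)

theory Defs
  imports "HOL-Probability.Probability"
begin

definition radon :: "'a::t2_space measure \<Rightarrow> bool" where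
  "radon \<nu> \<longleftrightarrow> sets \<nu> = sets borel \<and>
     (\<forall>K. compact K \<longrightarrow> emeasure \<nu> K < \<infinity>) \<and>
     (\<forall>B\<in>sets borel. emeasure \<nu> B = (SUP K\<in>{K. compact K \<and> K \<subseteq> B}. emeasure \<nu> K))"

definition diffuse :: "'a::topological_space measure \<Rightarrow> bool" where
  "diffuse \<nu> \<longleftrightarrow> (\<forall>y. emeasure \<nu> {y} = 0)"

definition measure_support :: "'a::topological_space measure \<Rightarrow> 'a set" where
  "measure_support \<nu> = {y. \<forall>U. open U \<and> y \<in> U \<longrightarrow> emeasure \<nu> U > 0}"

(* A configuration is the set of atoms of a Radon measure of the form
   \<Sum>\<^sub>k \<delta>(y\<^sub>k) with at most countably many, pairwise distinct points y\<^sub>k;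
   adding a point y to a configuration is then insert y. *)
definition configurations :: "'a::topological_space set set" where
  "configurations = {\<omega>. countable \<omega> \<and> (\<forall>K. compact K \<longrightarrow> finite (\<omega> \<inter> K))}"

(* The number \<omega>(B) of points in B, possibly infinite. *)
definition config_count :: "'a set \<Rightarrow> 'a set \<Rightarrow> ennreal" where
  "config_count B \<omega> = emeasure (count_space UNIV) (\<omega> \<inter> B)"

definition config_space :: "'a::topological_space set measure" where
  "config_space = sigma configurations
     {config_count B -` A \<inter> configurations | A B. A \<in> sets borel \<and> B \<in> sets borel}"

definition poisson_law :: "'a::topological_space measure \<Rightarrow> 'a set measure \<Rightarrow> bool" where
  "poisson_law \<nu> Q \<longleftrightarrow> prob_space Q \<and> sets Q = sets config_space \<and>
     (\<forall>B\<in>sets borel. emeasure \<nu> B < \<infinity> \<longrightarrow>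
        (\<forall>k::nat. measure Q {\<omega>\<in>space Q. config_count B \<omega> = of_nat k}
           = exp (- measure \<nu> B) * measure \<nu> B ^ k / fact k)) \<and>
     (\<forall>(m::nat) B. (\<forall>j<m. B j \<in> sets borel \<and> emeasure \<nu> (B j) < \<infinity>) \<and>
        disjoint_family_on B {..<m} \<longrightarrow>
        prob_space.indep_vars Q (\<lambda>_. borel) (\<lambda>j. config_count (B j)) {..<m})"

definition add_point_diff :: "'a \<Rightarrow> ('a set \<Rightarrow> real) \<Rightarrow> 'a set \<Rightarrow> real" where
  "add_point_diff y f \<omega> = f (insert y \<omega>) - f \<omega>"

(* A genuine supremum over all configurations, not an essential one.  A
   functional of the i-th component is represented as a function on
   configurations of Y, so only that component appears. *)
definition lip_const :: "('a::real_normed_vector set \<Rightarrow> real) \<Rightarrow> ennreal" where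
  "lip_const f = (SUP (y, \<omega>)\<in>(UNIV - {0}) \<times> configurations.
     ennreal (\<bar>add_point_diff y f \<omega>\<bar> / norm y))"

end

theory Submission
  imports Defs
begin

text \<open>
  Let \<^term>\<open>m\<close> be the mean of the Euclidean norm \<open>|F|\<close> and put \<open>G = max |F| m\<close>, so that
  \<open>E G \<le> 2 m\<close> and it suffices to bound the upper deviations of \<open>G\<close> above its mean.
  Truncation at \<open>m\<close> makes the squared increments of \<open>G\<close>, summed over all components and
  integrated over the added point, at most \<open>\<alpha>2\<close>, because \<open>m\<^sup>2 \<ge> n (E|F\<^sub>1|)\<^sup>2\<close>.

  The deviation inequality on Poisson space comes from a Bernoulli approximation.  One step adds a
  random point with probability \<open>p = \<Lambda>/M\<close>; this averaging operator commutes with adding a point, so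
  it preserves the bounds on the increments, and it satisfies
  \<open>T e\<^sup>s\<^sup>G \<le> e\<^sup>s\<^sup>T\<^sup>G exp (p v (e\<^sup>s\<^sup>K - 1 - s K)/K\<^sup>2)\<close>.  Iterating \<open>M\<close> times and letting \<open>M\<close> grow gives the
  bound on the Laplace transform for a Poisson number of independent points.

  The given law is identified with this explicit model by Renyi's argument: a simple point
  process is determined by its void probabilities.  A Radon intensity with finite second moment and
  bounded support is finite and carried by a \<open>\<sigma>\<close>-compact set, on which countably many open sets
  separate points, and this replaces separability of the ambient space.  If the second moment is
  infinite, the Bochner integral is \<open>0\<close> and the claimed bound is trivial.
\<close>

section \<open>Elementary estimates\<close>

text \<open>If an added point changes only F_i, by d, then |F'|^2 - |F|^2 = 2 F_i d + d^2, whose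
  square is at most 8 F_i^2 d^2 + 2 d^4: hence the constants 8 and 2. The difference of the
  truncated norms costs a division by (G + m)^2, which is at least |F|^2 and at least m^2. Summed
  over i, the first term becomes 8 beta^2 because the F_i^2 add up to |F|^2, and the second is
  controlled by n / m^2 <= 1 / (E|F_1|)^2, so the dimension disappears. The n components are merged
  into one Poisson process of total mass n nu(Y) whose points carry a uniform mark. One added point
  then touches one coordinate, and a single averaging operator is enough. Bernoulli steps keep every
  functional on finite configurations, where all estimates are elementary and hold pointwise. The
  supremum defining beta excludes y = 0, so the model must never insert the origin; diffuseness
  makes it a null set. The final exponent is Bennett's, obtained by optimising over s, with largest
  jump beta R.\<close>

lemma exp_sub_quadratic_le:
  fixes u v :: real
  assumes "\<bar>u\<bar> \<le> v" "v > 0"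
  shows "exp u - 1 - u \<le> u\<^sup>2 * ((exp v - 1 - v) / v\<^sup>2)"
proof -
  \<comment> \<open>(exp w - 1 - w) / w^2 is a power series with nonnegative coefficients, so its
    value at \<open>u\<close> is at most its value at \<open>v\<close> once |u| <= v. Multiplying by
    w^2 keeps w = 0 covered.\<close>
  have split: "exp w - 1 - w = w\<^sup>2 * (\<Sum>k. w ^ k / fact (k + 2))"
    and summ: "summable (\<lambda>k. w ^ k / fact (k + 2))" for w :: real
  proof -
    have s: "(\<lambda>k. w ^ k / fact k) sums exp w"
      using exp_converges[of w] by (simp add: divide_inverse mult.commute)
    have "(\<lambda>k. w ^ (k + 2) / fact (k + 2)) sums (exp w - (\<Sum>k<2. w ^ k / fact k))"
      using s by (rule sums_split_initial_segment)
    then have s2: "(\<lambda>k. w\<^sup>2 * (w ^ k / fact (k + 2))) sums (exp w - 1 - w)"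
      by (simp add: numeral_2_eq_2 power2_eq_square algebra_simps)
    show summ: "summable (\<lambda>k. w ^ k / fact (k + 2))"
    proof (cases "w = 0")
      case True
      then show ?thesis
        by (intro summable_finite[of "{0}"]) (auto simp: power_0_left)
    next
      case False
      then show ?thesis
        using sums_summable[OF s2] by (subst (asm) summable_cmult_iff) auto
    qed
    show "exp w - 1 - w = w\<^sup>2 * (\<Sum>k. w ^ k / fact (k + 2))"
      using sums_unique[OF s2] suminf_mult[OF summ, of "w\<^sup>2"] by simp
  qed
  have "(\<Sum>k. u ^ k / fact (k + 2)) \<le> (\<Sum>k. v ^ k / fact (k + 2))"
  proof (intro suminf_le summ divide_right_mono)
    fix k
    have "u ^ k \<le> \<bar>u\<bar> ^ k" by (simp add: power_abs[symmetric])
    also have "\<dots> \<le> v ^ k" using assms by (intro power_mono) auto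
    finally show "u ^ k \<le> v ^ k" .
  qed simp
  also have "\<dots> = (exp v - 1 - v) / v\<^sup>2"
    using split[of v] \<open>v > 0\<close> by simp
  finally show ?thesis
    by (subst split[of u]) (intro mult_left_mono, auto)
qed

text \<open>Pascal's rule in the form of one more Bernoulli trial: if \<open>a k\<close> is the
  value after k successes, a further trial replaces it by the weighted sum of \<open>a k\<close> and
  \<open>a (Suc k)\<close>.\<close>

lemma sum_binomial_Suc:
  fixes p q :: "'a::comm_semiring_1"
  shows "(\<Sum>k\<le>M. of_nat (M choose k) * p ^ k * q ^ (M - k) * (q * a k + p * a (Suc k)))
    = (\<Sum>k\<le>Suc M. of_nat (Suc M choose k) * p ^ k * q ^ (Suc M - k) * a k)" (is "?L = ?R")
proof -
  have "?L = (\<Sum>k\<le>M. of_nat (M choose k) * p ^ k * q ^ (Suc M - k) * a k)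
      + (\<Sum>k\<le>M. of_nat (M choose k) * p ^ Suc k * q ^ (M - k) * a (Suc k))"
    by (simp add: sum.distrib[symmetric] distrib_left Suc_diff_le mult_ac)
  also have "(\<Sum>k\<le>M. of_nat (M choose k) * p ^ k * q ^ (Suc M - k) * a k)
      = (\<Sum>k\<le>Suc M. of_nat (M choose k) * p ^ k * q ^ (Suc M - k) * a k)"
    by (simp add: binomial_eq_0)
  also have "\<dots> = q ^ Suc M * a 0
      + (\<Sum>k\<le>M. of_nat (M choose Suc k) * p ^ Suc k * q ^ (M - k) * a (Suc k))"
    by (subst sum.atMost_Suc_shift) simp
  also have "\<dots> + (\<Sum>k\<le>M. of_nat (M choose k) * p ^ Suc k * q ^ (M - k) * a (Suc k)) = ?R"
    by (subst sum.atMost_Suc_shift) (simp add: sum.distrib[symmetric] algebra_simps)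
  finally show ?thesis .
qed

text \<open>The factor exp (-\<Lambda>) of the limit is given up in exchange for uniformity in
  \<open>M\<close>; this is the majorant in \<open>step_funpow_tendsto_poisson\<close>.\<close>

lemma binomial_weight_le:
  fixes \<Lambda> :: real
  assumes "\<Lambda> \<ge> 0" "\<Lambda> \<le> real M" "M > 0"
  shows "real (M choose k) * (\<Lambda> / M) ^ k * (1 - \<Lambda> / M) ^ (M - k) \<le> \<Lambda> ^ k / fact k"
proof -
  have "real (M choose k) * fact k \<le> real M ^ k"
    using binomial_fact_pow[of M k] by (metis of_nat_fact of_nat_le_iff of_nat_mult of_nat_power)
  then have "real (M choose k) * (\<Lambda> / M) ^ k \<le> real M ^ k / fact k * (\<Lambda> / M) ^ k"
    using assms by (intro mult_right_mono) (auto simp: field_simps)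
  also have "\<dots> = \<Lambda> ^ k / fact k"
    using assms by (simp add: power_divide)
  finally have 1: "real (M choose k) * (\<Lambda> / M) ^ k \<le> \<Lambda> ^ k / fact k" .
  have "real (M choose k) * (\<Lambda> / M) ^ k * (1 - \<Lambda> / M) ^ (M - k)
      \<le> real (M choose k) * (\<Lambda> / M) ^ k"
    using assms by (intro mult_left_le power_le_one mult_nonneg_nonneg) auto
  with 1 show ?thesis by linarith
qed

text \<open>The weight factors into \<Lambda>^k / k!, the falling factorial of M divided by M^k, and
  (1 - \<Lambda>/M)^(M - k); for fixed k the last two tend to 1 and exp (-\<Lambda>).\<close>

lemma binomial_weight_tendsto:
  fixes \<Lambda> :: real
  assumes "\<Lambda> \<ge> 0"
  shows "(\<lambda>M. real (M choose k) * (\<Lambda> / M) ^ k * (1 - \<Lambda> / M) ^ (M - k))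
    \<longlonglongrightarrow> \<Lambda> ^ k / fact k * exp (- \<Lambda>)"
proof -
  have lin: "(\<lambda>M. 1 - c / real M) \<longlonglongrightarrow> 1" for c :: real
    using tendsto_diff[OF tendsto_const[of 1] lim_const_over_n[of c]] by simp
  have "(\<lambda>M. \<Prod>i<k. 1 - real i / real M) \<longlonglongrightarrow> (\<Prod>i<k. 1)"
    by (intro tendsto_prod lin)
  moreover have "(\<lambda>M. (1 - \<Lambda> / M) ^ M / (1 - \<Lambda> / M) ^ k) \<longlonglongrightarrow> exp (- \<Lambda>) / 1 ^ k"
    using tendsto_exp_limit_sequentially[of "- \<Lambda>"]
    by (intro tendsto_divide tendsto_power lin) auto
  ultimately have lim: "(\<lambda>M. \<Lambda> ^ k / fact k * (\<Prod>i<k. 1 - real i / real M)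
        * ((1 - \<Lambda> / M) ^ M / (1 - \<Lambda> / M) ^ k)) \<longlonglongrightarrow> \<Lambda> ^ k / fact k * (\<Prod>i<k. 1) * (exp (- \<Lambda>) / 1 ^ k)"
    by (intro tendsto_mult tendsto_const)
  have "eventually (\<lambda>M. real M > \<Lambda> \<and> M > 0 \<and> M \<ge> k) at_top"
    using eventually_gt_at_top[of "nat \<lceil>\<Lambda>\<rceil>"] eventually_ge_at_top[of k]
    by eventually_elim linarith
  then have "eventually (\<lambda>M. \<Lambda> ^ k / fact k * (\<Prod>i<k. 1 - real i / real M)
        * ((1 - \<Lambda> / M) ^ M / (1 - \<Lambda> / M) ^ k)
      = real (M choose k) * (\<Lambda> / M) ^ k * (1 - \<Lambda> / M) ^ (M - k)) at_top"
  proof eventually_elim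
    case (elim M)
    have "(\<Prod>i<k. 1 - real i / real M) = (\<Prod>i<k. (real M - real i) / real M)"
      using elim by (intro prod.cong) (auto simp: diff_divide_distrib)
    also have "\<dots> = (\<Prod>i<k. real M - real i) / real M ^ k"
      by (simp add: prod_dividef)
    also have "(\<Prod>i<k. real M - real i) = fact k * real (M choose k)"
      by (simp add: binomial_gbinomial gbinomial_prod_rev lessThan_atLeast0)
    finally have 1: "(\<Prod>i<k. 1 - real i / real M) = fact k * real (M choose k) / real M ^ k" .
    have "1 - \<Lambda> / M \<noteq> 0" using elim by (auto simp: field_simps)
    then have 2: "(1 - \<Lambda> / M) ^ M / (1 - \<Lambda> / M) ^ k = (1 - \<Lambda> / M) ^ (M - k)"
      using elim by (simp add: power_diff)
    show ?case
      unfolding 1 2 by (simp add: power_divide)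
  qed
  with lim show ?thesis
    by (subst tendsto_cong[symmetric]) auto
qed

lemma (in prob_space) power2_integral_le:
  fixes f :: "'a \<Rightarrow> real"
  assumes "integrable M f" "integrable M (\<lambda>x. (f x)\<^sup>2)"
  shows "(\<integral>x. f x \<partial>M)\<^sup>2 \<le> (\<integral>x. (f x)\<^sup>2 \<partial>M)"
  using variance_positive[of f] variance_eq[OF assms] by simp

text \<open>Shift invariance of an i.i.d. sequence. It absorbs an integration over one point into
  the integral over the stream.\<close>

lemma (in prob_space) stream_space_Stream_distr:
  "stream_space M = distr (M \<Otimes>\<^sub>M stream_space M) (stream_space M) (\<lambda>y. fst y ## snd y)"
proof -
  interpret S: prob_space "stream_space M" by (rule prob_space_stream_space)
  show ?thesis
  proof (rule measure_eqI)
    fix A assume A[measurable]: "A \<in> sets (stream_space M)"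
    have "emeasure (stream_space M) A = (\<integral>\<^sup>+X. indicator A X \<partial>stream_space M)"
      by simp
    also have "\<dots> = (\<integral>\<^sup>+x. (\<integral>\<^sup>+X. indicator A (x ## X) \<partial>stream_space M) \<partial>M)"
      by (rule nn_integral_stream_space) measurable
    also have "\<dots> = (\<integral>\<^sup>+y. indicator A (fst y ## snd y) \<partial>(M \<Otimes>\<^sub>M stream_space M))"
      by (subst S.nn_integral_fst[symmetric]) auto
    also have "\<dots> = (\<integral>\<^sup>+y. indicator A y \<partial>distr (M \<Otimes>\<^sub>M stream_space M) (stream_space M) (\<lambda>y. fst y ## snd y))"
      by (subst nn_integral_distr) (auto simp: case_prod_beta)
    finally show "emeasure (stream_space M) A
        = emeasure (distr (M \<Otimes>\<^sub>M stream_space M) (stream_space M) (\<lambda>y. fst y ## snd y)) A"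
      by (subst (asm) nn_integral_indicator) auto
  qed simp
qed

section \<open>Exponential moments for a Poisson number of random points\<close>

text \<open>With the whole type as space, prepending arbitrary points to a stream is measurable and
  points of configurations carry no side condition.\<close>

locale point_source = prob_space \<mu> for \<mu> :: "'x measure" +
  assumes space_UNIV: "space \<mu> = UNIV"
begin

sublocale seq: prob_space "stream_space \<mu>"
  by (rule prob_space_stream_space)

sublocale pair_seq: pair_prob_space \<mu> "stream_space \<mu>" ..

sublocale pair2: pair_prob_space \<mu> \<mu> ..

lemma space_stream_UNIV: "space (stream_space \<mu>) = UNIV"
  by (simp add: space_stream_space space_UNIV)

text \<open>Functionals are only evaluated on finite configurations, and only measurability along
  enumerations of the points is needed, so no \<open>\<sigma>\<close>-algebra on \<^typ>\<open>'x set\<close> appears.\<close>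

definition tame :: "('x set \<Rightarrow> real) \<Rightarrow> bool" where
  "tame f \<longleftrightarrow> (\<forall>k. (\<lambda>X. f (set (stake k X))) \<in> borel_measurable (stream_space \<mu>)) \<and>
     (\<exists>C a. a \<ge> 1 \<and> C \<ge> 0 \<and> (\<forall>\<omega>. finite \<omega> \<longrightarrow> \<bar>f \<omega>\<bar> \<le> C * a ^ card \<omega>))"

section \<open>Tame functionals: measurability and integrability\<close>

lemma measurable_shift_const: "(\<lambda>X. xs @- X) \<in> measurable (stream_space \<mu>) (stream_space \<mu>)"
  by (induction xs) (auto simp: space_UNIV intro!: measurable_Stream)

text \<open>Listing the points of \<open>\<omega>\<close> in front of the stream turns the union
  into the point set of a longer prefix.\<close>

lemma tameD_union:
  assumes "tame f" "finite \<omega>"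
  shows "(\<lambda>X. f (\<omega> \<union> set (stake k X))) \<in> borel_measurable (stream_space \<mu>)"
proof -
  obtain xs where xs: "\<omega> = set xs" using \<open>finite \<omega>\<close> finite_list by blast
  have "(\<lambda>X. f (set (stake (length xs + k) X))) \<in> borel_measurable (stream_space \<mu>)"
    using assms(1) by (simp add: tame_def)
  from measurable_compose[OF measurable_shift_const this, of xs] show ?thesis
    by (simp add: xs stake_shift)
qed

lemma tameD_insert:
  assumes "tame f" "finite \<omega>"
  shows "(\<lambda>z. f (insert z \<omega>)) \<in> borel_measurable \<mu>"
proof -
  \<comment> \<open>\<open>X0\<close> is padding: only the first entry of \<open>z ## X0\<close> is
    read.\<close>
  obtain X0 :: "'x stream" where "X0 \<in> UNIV" by blast
  have "(\<lambda>z. z ## X0) \<in> measurable \<mu> (stream_space \<mu>)"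
    by (intro measurable_Stream) (auto simp: space_stream_UNIV)
  from measurable_compose[OF this tameD_union[OF assms, of 1]] show ?thesis
    by simp
qed

lemma tameD_insert2:
  assumes "tame f" "finite \<omega>"
  shows "(\<lambda>(z, w). f (insert z (insert w \<omega>))) \<in> borel_measurable (\<mu> \<Otimes>\<^sub>M \<mu>)"
proof -
  obtain X0 :: "'x stream" where "X0 \<in> UNIV" by blast
  have "(\<lambda>(z, w). w ## z ## X0) \<in> measurable (\<mu> \<Otimes>\<^sub>M \<mu>) (stream_space \<mu>)"
    unfolding split_beta by (intro measurable_Stream) (auto simp: space_stream_UNIV)
  from measurable_compose[OF this tameD_union[OF assms, of "Suc (Suc 0)"]] show ?thesis
    by (simp add: split_beta insert_commute)
qed

lemma tameD_bound:
  assumes "tame f"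
  obtains C a where "a \<ge> 1" "C \<ge> 0" "\<And>\<omega>. finite \<omega> \<Longrightarrow> \<bar>f \<omega>\<bar> \<le> C * a ^ card \<omega>"
    "\<And>\<omega> k. finite \<omega> \<Longrightarrow> card \<omega> \<le> k \<Longrightarrow> \<bar>f \<omega>\<bar> \<le> C * a ^ k"
proof -
  obtain C a where *: "a \<ge> 1" "C \<ge> 0" "\<And>\<omega>. finite \<omega> \<Longrightarrow> \<bar>f \<omega>\<bar> \<le> C * a ^ card \<omega>"
    using assms unfolding tame_def by blast
  moreover have "\<bar>f \<omega>\<bar> \<le> C * a ^ k" if "finite \<omega>" "card \<omega> \<le> k" for \<omega> k
    using *(3)[OF that(1)] mult_left_mono[OF power_increasing[OF that(2) *(1)] *(2)] by linarith
  ultimately show ?thesis using that by blast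
qed

lemma tame_integrable_insert:
  assumes "tame f" "finite \<omega>"
  shows "integrable \<mu> (\<lambda>z. f (insert z \<omega>))"
proof -
  obtain C a where "\<And>\<omega> k. finite \<omega> \<Longrightarrow> card \<omega> \<le> k \<Longrightarrow> \<bar>f \<omega>\<bar> \<le> C * a ^ k"
    using tameD_bound[OF assms(1)] by metis
  then have "\<bar>f (insert z \<omega>)\<bar> \<le> C * a ^ Suc (card \<omega>)" for z
    using assms(2) card_insert_le_m1[of "Suc (card \<omega>)" \<omega> z] finite_insert[of z \<omega>] diff_Suc_1 le_refl zero_less_Suc
    by metis
  then show ?thesis
    using tameD_insert[OF assms] by (intro integrable_const_bound[where B = "C * a ^ Suc (card \<omega>)"]) auto
qed

lemma tame_integrable_union:
  assumes "tame f" "finite \<omega>"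
  shows "integrable (stream_space \<mu>) (\<lambda>X. f (\<omega> \<union> set (stake k X)))"
proof -
  obtain C a where *: "\<And>\<omega> k. finite \<omega> \<Longrightarrow> card \<omega> \<le> k \<Longrightarrow> \<bar>f \<omega>\<bar> \<le> C * a ^ k"
    using tameD_bound[OF assms(1)] by metis
  have "\<bar>f (\<omega> \<union> set (stake k X))\<bar> \<le> C * a ^ (card \<omega> + k)" for X
    using assms(2) card_Un_le[of \<omega> "set (stake k X)"] card_length[of "stake k X"]
    by (intro *) auto
  then show ?thesis
    using tameD_union[OF assms]
    by (intro seq.integrable_const_bound[where B = "C * a ^ (card \<omega> + k)"]) auto
qed

lemma tame_lincomb:
  assumes "tame f" "tame g"
  shows "tame (\<lambda>\<omega>. p * f \<omega> + q * g \<omega>)"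
proof -
  obtain C a where f: "a \<ge> 1" "C \<ge> 0" "\<And>\<omega>. finite \<omega> \<Longrightarrow> \<bar>f \<omega>\<bar> \<le> C * a ^ card \<omega>"
    using tameD_bound[OF assms(1)] by metis
  obtain D b where g: "b \<ge> 1" "D \<ge> 0" "\<And>\<omega>. finite \<omega> \<Longrightarrow> \<bar>g \<omega>\<bar> \<le> D * b ^ card \<omega>"
    using tameD_bound[OF assms(2)] by metis
  have "\<bar>p * f \<omega> + q * g \<omega>\<bar> \<le> (\<bar>p\<bar> * C + \<bar>q\<bar> * D) * (max a b) ^ card \<omega>" if "finite \<omega>" for \<omega>
  proof -
    have "\<bar>p * f \<omega> + q * g \<omega>\<bar> \<le> \<bar>p\<bar> * \<bar>f \<omega>\<bar> + \<bar>q\<bar> * \<bar>g \<omega>\<bar>"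
      by (metis abs_mult abs_triangle_ineq)
    also have "\<dots> \<le> \<bar>p\<bar> * (C * max a b ^ card \<omega>) + \<bar>q\<bar> * (D * max a b ^ card \<omega>)"
      using f g that
      by (intro add_mono mult_left_mono order_trans[OF f(3)] order_trans[OF g(3)] power_mono) auto
    finally show ?thesis by (simp add: algebra_simps)
  qed
  moreover have "max a b \<ge> 1" "\<bar>p\<bar> * C + \<bar>q\<bar> * D \<ge> 0" using f g by auto
  ultimately show ?thesis
    using assms unfolding tame_def
    by (intro conjI allI borel_measurable_add borel_measurable_times borel_measurable_const) blast+
qed

section \<open>Averaging over one added point, and its iterates\<close>

definition avg :: "('x set \<Rightarrow> real) \<Rightarrow> 'x set \<Rightarrow> real" where
  "avg f \<omega> = (\<integral>z. f (insert z \<omega>) \<partial>\<mu>)"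

definition step :: "real \<Rightarrow> ('x set \<Rightarrow> real) \<Rightarrow> 'x set \<Rightarrow> real" where
  "step p f \<omega> = (1 - p) * f \<omega> + p * avg f \<omega>"

text \<open>Averaging adds one point, so the base \<open>a\<close> stays and the constant grows from
  C to C * a. Measurability along k points follows from measurability along k + 1 points by
  integrating one of them out.\<close>

lemma tame_avg:
  assumes "tame f"
  shows "tame (avg f)"
proof -
  obtain C a where f: "a \<ge> 1" "C \<ge> 0" "\<And>\<omega> k. finite \<omega> \<Longrightarrow> card \<omega> \<le> k \<Longrightarrow> \<bar>f \<omega>\<bar> \<le> C * a ^ k"
    using tameD_bound[OF assms(1)] by metis
  have "\<bar>avg f \<omega>\<bar> \<le> (C * a) * a ^ card \<omega>" if "finite \<omega>" for \<omega>
  proof -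
    have "\<bar>f (insert z \<omega>)\<bar> \<le> C * a ^ Suc (card \<omega>)" for z
      using that by (intro f) (simp_all add: card_insert_le_m1)
    then have "- (C * a ^ Suc (card \<omega>)) \<le> f (insert z \<omega>) \<and> f (insert z \<omega>) \<le> C * a ^ Suc (card \<omega>)" for z
      by (metis abs_le_D1 abs_le_D2 minus_le_iff)
    then have "avg f \<omega> \<le> C * a ^ Suc (card \<omega>)" "- (C * a ^ Suc (card \<omega>)) \<le> avg f \<omega>"
      unfolding avg_def using tame_integrable_insert[OF assms that]
      by (auto intro!: integral_le_const integral_ge_const)
    then show ?thesis by auto
  qed
  moreover have "(\<lambda>X. avg f (set (stake k X))) \<in> borel_measurable (stream_space \<mu>)" for k
  proof -
    have "(\<lambda>X. f (set (stake (Suc k) X))) \<in> borel_measurable (stream_space \<mu>)"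
      using assms unfolding tame_def by blast
    moreover have "(\<lambda>(X, z). z ## X) \<in> measurable (stream_space \<mu> \<Otimes>\<^sub>M \<mu>) (stream_space \<mu>)"
      by measurable
    ultimately have "(\<lambda>y. f (set (stake (Suc k) (case y of (X, z) \<Rightarrow> z ## X)))) \<in> borel_measurable (stream_space \<mu> \<Otimes>\<^sub>M \<mu>)"
      by (rule measurable_compose[rotated])
    then have "(\<lambda>(X, z). f (insert z (set (stake k X)))) \<in> borel_measurable (stream_space \<mu> \<Otimes>\<^sub>M \<mu>)"
      by (simp add: split_beta)
    then show ?thesis
      unfolding avg_def by (rule borel_measurable_lebesgue_integral)
  qed
  moreover have "C * a \<ge> 0" using f by auto
  ultimately show ?thesis
    unfolding tame_def using f(1) by blast
qed

lemma tame_step: "tame f \<Longrightarrow> tame (step p f)"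
  unfolding step_def[abs_def] by (intro tame_lincomb tame_avg)

lemma tame_avg_funpow: "tame f \<Longrightarrow> tame ((avg ^^ k) f)"
  by (induction k) (auto intro: tame_avg)

lemma tame_step_funpow: "tame f \<Longrightarrow> tame ((step p ^^ k) f)"
  by (induction k) (auto intro: tame_step)

lemma avg_lincomb:
  assumes "tame f" "tame g" "finite \<omega>"
  shows "avg (\<lambda>\<omega>. p * f \<omega> + q * g \<omega>) \<omega> = p * avg f \<omega> + q * avg g \<omega>"
  unfolding avg_def using assms by (simp add: tame_integrable_insert)

lemma avg_cong:
  assumes "\<And>\<omega>. finite \<omega> \<Longrightarrow> f \<omega> = g \<omega>" "finite \<omega>"
  shows "avg f \<omega> = avg g \<omega>"
  unfolding avg_def using assms by (intro Bochner_Integration.integral_cong) auto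

text \<open>Linearity of \<open>avg\<close> needs the integrals to exist, which tameness ensures at
  finite \<open>\<omega>\<close> only; \<open>avg_cong\<close> carries the restricted equation
  through the induction.\<close>

lemma avg_funpow_step:
  assumes "tame f" "finite \<omega>"
  shows "(avg ^^ k) (step p f) \<omega> = (1 - p) * (avg ^^ k) f \<omega> + p * (avg ^^ Suc k) f \<omega>"
  using assms(2)
proof (induction k arbitrary: \<omega>)
  case 0
  then show ?case by (simp add: step_def)
next
  case (Suc k)
  have "(avg ^^ Suc k) (step p f) \<omega>
      = avg (\<lambda>\<omega>. (1 - p) * (avg ^^ k) f \<omega> + p * (avg ^^ Suc k) f \<omega>) \<omega>"
    unfolding funpow.simps comp_def using Suc by (intro avg_cong) (simp_all only: funpow.simps comp_def)
  also have "\<dots> = (1 - p) * (avg ^^ Suc k) f \<omega> + p * (avg ^^ Suc (Suc k)) f \<omega>"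
    using avg_lincomb[OF tame_avg_funpow[OF assms(1), of k] tame_avg_funpow[OF assms(1), of "Suc k"] Suc.prems]
    by simp
  finally show ?case .
qed

text \<open>On tame functionals \<open>step p\<close> is (1 - p) id + p \<open>avg\<close>, so its
  powers obey the binomial theorem. The induction peels off the innermost step, hence
  \<open>f\<close> varies.\<close>

lemma step_funpow_eq_binomial:
  assumes "tame f" "finite \<omega>"
  shows "(step p ^^ M) f \<omega>
    = (\<Sum>k\<le>M. real (M choose k) * p ^ k * (1 - p) ^ (M - k) * (avg ^^ k) f \<omega>)"
  using assms(1)
proof (induction M arbitrary: f)
  case 0
  then show ?case by simp
next
  case (Suc M)
  have "(step p ^^ Suc M) f \<omega> = (step p ^^ M) (step p f) \<omega>"
    by (simp only: funpow_Suc_right comp_def)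
  also have "\<dots> = (\<Sum>k\<le>M. real (M choose k) * p ^ k * (1 - p) ^ (M - k) *
      ((1 - p) * (avg ^^ k) f \<omega> + p * (avg ^^ Suc k) f \<omega>))"
    by (simp only: Suc.IH[OF tame_step[OF Suc.prems]] avg_funpow_step[OF Suc.prems assms(2)])
  also have "\<dots> = (\<Sum>k\<le>Suc M. real (Suc M choose k) * p ^ k * (1 - p) ^ (Suc M - k) * (avg ^^ k) f \<omega>)"
    by (rule sum_binomial_Suc)
  finally show ?case .
qed

text \<open>Iterated averages draw the points one at a time, the stream draws them all at once;
  Fubini on head and tail gives the induction step.\<close>

lemma avg_funpow_eq_integral:
  assumes "tame f" "finite \<omega>"
  shows "(avg ^^ k) f \<omega> = (\<integral>X. f (\<omega> \<union> set (stake k X)) \<partial>stream_space \<mu>)"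
  using assms(2)
proof (induction k arbitrary: \<omega>)
  case 0
  then show ?case by (simp add: seq.prob_space)
next
  case (Suc k)
  define g where "g = (\<lambda>X. f (\<omega> \<union> set (stake (Suc k) X)))"
  let ?c = "\<lambda>y. fst y ## snd y"
  have g: "integrable (stream_space \<mu>) g"
    unfolding g_def by (rule tame_integrable_union[OF assms(1) Suc.prems])
  have c[measurable]: "?c \<in> measurable (\<mu> \<Otimes>\<^sub>M stream_space \<mu>) (stream_space \<mu>)"
    by measurable
  have d: "distr (\<mu> \<Otimes>\<^sub>M stream_space \<mu>) (stream_space \<mu>) ?c = stream_space \<mu>"
    by (rule stream_space_Stream_distr[symmetric])
  have "(avg ^^ Suc k) f \<omega> = (\<integral>z. (\<integral>X. g (z ## X) \<partial>stream_space \<mu>) \<partial>\<mu>)"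
    using Suc by (simp add: avg_def[of "(avg ^^ k) f"] g_def)
  also have "\<dots> = (\<integral>y. g (?c y) \<partial>(\<mu> \<Otimes>\<^sub>M stream_space \<mu>))"
    using pair_seq.integral_fst'[of "\<lambda>y. g (?c y)"] integrable_distr[OF c, unfolded d, OF g] by simp
  also have "\<dots> = (\<integral>X. g X \<partial>stream_space \<mu>)"
    using integral_distr[OF c borel_measurable_integrable[OF g], unfolded d] by simp
  finally show ?case unfolding g_def .
qed

lemma avg_mono:
  assumes "tame f" "tame g" "\<And>\<omega>. finite \<omega> \<Longrightarrow> f \<omega> \<le> g \<omega>" "finite \<omega>"
  shows "avg f \<omega> \<le> avg g \<omega>"
  unfolding avg_def using assms by (intro integral_mono tame_integrable_insert) auto

lemma step_mono:
  assumes "tame f" "tame g" "\<And>\<omega>. finite \<omega> \<Longrightarrow> f \<omega> \<le> g \<omega>" "finite \<omega>" "0 \<le> p" "p \<le> 1"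
  shows "step p f \<omega> \<le> step p g \<omega>"
  unfolding step_def using assms by (intro add_mono mult_left_mono avg_mono) auto

lemma step_funpow_mono:
  assumes "tame f" "tame g" "\<And>\<omega>. finite \<omega> \<Longrightarrow> f \<omega> \<le> g \<omega>" "finite \<omega>" "0 \<le> p" "p \<le> 1"
  shows "(step p ^^ M) f \<omega> \<le> (step p ^^ M) g \<omega>"
  using assms(4)
proof (induction M arbitrary: \<omega>)
  case 0
  then show ?case using assms(3) by simp
next
  case (Suc M)
  show ?case
    unfolding funpow.simps comp_def
    by (rule step_mono[OF tame_step_funpow[OF assms(1)] tame_step_funpow[OF assms(2)] Suc.IH Suc.prems assms(5,6)])
qed

lemma step_cmult: "step p (\<lambda>\<omega>. c * f \<omega>) \<omega> = c * step p f \<omega>"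
  unfolding step_def avg_def by (simp add: algebra_simps)

lemma step_funpow_cmult: "(step p ^^ M) (\<lambda>\<omega>. c * f \<omega>) = (\<lambda>\<omega>. c * (step p ^^ M) f \<omega>)"
proof (induction M)
  case 0
  then show ?case by simp
next
  case (Suc M)
  show ?case
    unfolding funpow.simps comp_def Suc by (simp add: fun_eq_iff step_cmult)
qed

section \<open>Functionals with bounded increments and the one-step exponential inequality\<close>

lemma tame_mono_bound:
  assumes "\<And>k. (\<lambda>X. f (set (stake k X))) \<in> borel_measurable (stream_space \<mu>)"
    "a \<ge> 1" "C \<ge> 0" "\<And>\<omega>. finite \<omega> \<Longrightarrow> \<bar>f \<omega>\<bar> \<le> C * a ^ card \<omega>"
  shows "tame f"
  using assms unfolding tame_def by blast

lemma card_bound_of_increments: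
  fixes G :: "'x set \<Rightarrow> real"
  assumes "\<And>\<omega> z. finite \<omega> \<Longrightarrow> \<bar>G (insert z \<omega>) - G \<omega>\<bar> \<le> K" "finite \<omega>"
  shows "\<bar>G \<omega>\<bar> \<le> \<bar>G {}\<bar> + K * card \<omega>"
  using assms(2)
proof induction
  case empty
  then show ?case by simp
next
  case (insert z \<omega>)
  have "\<bar>G (insert z \<omega>)\<bar> \<le> \<bar>G \<omega>\<bar> + K" using assms(1)[OF insert.hyps(1), of z] by linarith
  then show ?case using insert by (simp add: algebra_simps)
qed

text \<open>Bounded increments give linear growth in the number of points, and the exponential turns
  this into geometric growth. This is the growth rate that \<open>tame\<close> has to admit.\<close>

lemma tame_exp:
  assumes "\<And>k. (\<lambda>X. G (set (stake k X))) \<in> borel_measurable (stream_space \<mu>)"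
    "\<And>\<omega> z. finite \<omega> \<Longrightarrow> \<bar>G (insert z \<omega>) - G \<omega>\<bar> \<le> K" "s \<ge> 0"
  shows "tame (\<lambda>\<omega>. exp (s * G \<omega>))"
proof (rule tame_mono_bound)
  have K: "K \<ge> 0" using assms(2)[of "{}"] by (meson abs_ge_zero finite.emptyI order_trans)
  show "exp (s * K) \<ge> 1" using K assms(3) by simp
  show "exp (s * \<bar>G {}\<bar>) \<ge> 0" by simp
  show "\<bar>exp (s * G \<omega>)\<bar> \<le> exp (s * \<bar>G {}\<bar>) * exp (s * K) ^ card \<omega>" if "finite \<omega>" for \<omega>
  proof -
    have "G \<omega> \<le> \<bar>G {}\<bar> + K * card \<omega>"
      using card_bound_of_increments[of G K, OF assms(2) that] by linarith
    then have "s * G \<omega> \<le> s * (\<bar>G {}\<bar> + K * card \<omega>)"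
      using assms(3) by (rule mult_left_mono)
    then have "exp (s * G \<omega>) \<le> exp (s * \<bar>G {}\<bar> + real (card \<omega>) * (s * K))"
      by (simp add: algebra_simps)
    then show ?thesis by (simp add: exp_add exp_of_nat_mult)
  qed
qed (use assms(1) in measurable)

text \<open>Bernoulli's inequality puts linear growth below a geometric bound with base 1 + K; the
  extra 1 in the constant covers G {} = 0.\<close>

lemma tame_of_increments:
  assumes "\<And>k. (\<lambda>X. G (set (stake k X))) \<in> borel_measurable (stream_space \<mu>)"
    "\<And>\<omega> z. finite \<omega> \<Longrightarrow> \<bar>G (insert z \<omega>) - G \<omega>\<bar> \<le> K"
  shows "tame G"
proof (rule tame_mono_bound)
  have K: "K \<ge> 0" using assms(2)[of "{}"] by (meson abs_ge_zero finite.emptyI order_trans)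
  show "1 + K \<ge> 1" "\<bar>G {}\<bar> + 1 \<ge> 0" using K by simp_all
  show "\<bar>G \<omega>\<bar> \<le> (\<bar>G {}\<bar> + 1) * (1 + K) ^ card \<omega>" if "finite \<omega>" for \<omega>
  proof -
    have 1: "1 + real (card \<omega>) * K \<le> (1 + K) ^ card \<omega>"
      using K by (intro Bernoulli_inequality) simp
    have "\<bar>G \<omega>\<bar> \<le> \<bar>G {}\<bar> + K * card \<omega>"
      by (rule card_bound_of_increments[of G K, OF assms(2) that])
    also have "\<dots> \<le> (\<bar>G {}\<bar> + 1) * (1 + real (card \<omega>) * K)"
      using K by (simp add: algebra_simps)
    also have "\<dots> \<le> (\<bar>G {}\<bar> + 1) * (1 + K) ^ card \<omega>"
      using 1 by (intro mult_left_mono) auto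
    finally show ?thesis .
  qed
qed (use assms(1) in measurable)

text \<open>The two inputs of a Bennett inequality: the largest jump and the mean square jump. The
  mean is over the normalised law \<open>\<mu>\<close>, so the variance bound for a Poisson number
  of points will be \<open>\<Lambda> * v\<close>.\<close>

definition lip :: "real \<Rightarrow> real \<Rightarrow> ('x set \<Rightarrow> real) \<Rightarrow> bool" where
  "lip K v G \<longleftrightarrow> (\<forall>\<omega> z. finite \<omega> \<longrightarrow> \<bar>G (insert z \<omega>) - G \<omega>\<bar> \<le> K) \<and>
     (\<forall>\<omega>. finite \<omega> \<longrightarrow> (\<integral>z. (G (insert z \<omega>) - G \<omega>)\<^sup>2 \<partial>\<mu>) \<le> v)"

lemma lipD:
  assumes "lip K v G" "finite \<omega>"
  shows "\<bar>G (insert z \<omega>) - G \<omega>\<bar> \<le> K" "(\<integral>z. (G (insert z \<omega>) - G \<omega>)\<^sup>2 \<partial>\<mu>) \<le> v"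
  using assms unfolding lip_def by auto

lemma integrable_increment:
  assumes "tame G" "lip K v G" "finite \<omega>"
  shows "integrable \<mu> (\<lambda>z. G (insert z \<omega>) - G \<omega>)"
    "integrable \<mu> (\<lambda>z. (G (insert z \<omega>) - G \<omega>)\<^sup>2)"
proof -
  note [measurable] = tameD_insert[OF assms(1,3)]
  show "integrable \<mu> (\<lambda>z. G (insert z \<omega>) - G \<omega>)"
    using tame_integrable_insert[OF assms(1,3)] by simp
  have "(G (insert z \<omega>) - G \<omega>)\<^sup>2 \<le> K\<^sup>2" for z
    using lipD(1)[OF assms(2,3), of z] by (simp add: abs_le_square_iff[symmetric])
  then show "integrable \<mu> (\<lambda>z. (G (insert z \<omega>) - G \<omega>)\<^sup>2)"
    by (intro integrable_const_bound[where B = "K\<^sup>2"]) auto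
qed

lemma avg_eq_increment:
  assumes "tame G" "finite \<omega>"
  shows "avg G \<omega> = G \<omega> + (\<integral>z. G (insert z \<omega>) - G \<omega> \<partial>\<mu>)"
  unfolding avg_def using tame_integrable_insert[OF assms] by (simp add: prob_space)

text \<open>Adding a point commutes with averaging: the increment of \<open>avg G\<close> at
  \<open>z\<close> is the mean over \<open>w\<close> of the increments of \<open>G\<close> at
  \<open>insert w \<omega>\<close>. Jensen's inequality and an exchange of integrals then use the
  bound for \<open>G\<close> at each finite configuration \<open>insert w \<omega>\<close>.\<close>

lemma lip_avg_square:
  assumes "tame G" "lip K v G" "finite \<omega>"
  shows "(\<integral>z. (avg G (insert z \<omega>) - avg G \<omega>)\<^sup>2 \<partial>\<mu>) \<le> v"
    and "integrable \<mu> (\<lambda>z. (avg G (insert z \<omega>) - avg G \<omega>)\<^sup>2)"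
    and "\<bar>avg G (insert z \<omega>) - avg G \<omega>\<bar> \<le> K"
proof -
  define D where "D z w = G (insert z (insert w \<omega>)) - G (insert w \<omega>)" for z w
  have D: "\<bar>D z w\<bar> \<le> K" for z w
    unfolding D_def using assms(3) by (intro lipD(1)[OF assms(2)]) simp
  have D2: "(D z w)\<^sup>2 \<le> K\<^sup>2" for z w
    using D[of z w] by (simp add: abs_le_square_iff[symmetric])
  have [measurable]: "(\<lambda>y. D (fst y) (snd y)) \<in> borel_measurable (\<mu> \<Otimes>\<^sub>M \<mu>)"
    unfolding D_def using tameD_insert2[OF assms(1,3)] tameD_insert[OF assms(1,3)]
    by (intro borel_measurable_diff measurable_compose[OF measurable_snd]) (auto simp: split_beta)
  have iD: "integrable \<mu> (D z)" for z
    unfolding D_def using assms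
    by (intro Bochner_Integration.integrable_diff)
      (auto simp: insert_commute[of z] intro!: tame_integrable_insert)
  then have [measurable]: "D z \<in> borel_measurable \<mu>" for z by auto
  have iD2: "integrable \<mu> (\<lambda>w. (D z w)\<^sup>2)" for z
    using D2 by (intro integrable_const_bound[where B = "K\<^sup>2"]) auto
  have ii: "integrable (\<mu> \<Otimes>\<^sub>M \<mu>) (\<lambda>y. (D (fst y) (snd y))\<^sup>2)"
    using D2 by (intro pair2.P.integrable_const_bound[where B = "K\<^sup>2"]) auto
  have avgD: "avg G (insert z \<omega>) - avg G \<omega> = (\<integral>w. D z w \<partial>\<mu>)" for z
    unfolding avg_def D_def using assms
    by (subst insert_commute) (auto intro!: Bochner_Integration.integral_diff[symmetric] tame_integrable_insert)
  have le: "(\<integral>w. D z w \<partial>\<mu>)\<^sup>2 \<le> (\<integral>w. (D z w)\<^sup>2 \<partial>\<mu>)" for z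
    by (rule power2_integral_le[OF iD iD2])
  have "(\<integral>w. D z w \<partial>\<mu>) \<le> K" "- K \<le> (\<integral>w. D z w \<partial>\<mu>)" for z
    using iD[of z] D[of z] by (auto intro!: integral_le_const integral_ge_const simp: abs_le_iff minus_le_iff)
  then have absD: "\<bar>\<integral>w. D z w \<partial>\<mu>\<bar> \<le> K" for z
    by (simp add: abs_le_iff minus_le_iff)
  then show "\<bar>avg G (insert z \<omega>) - avg G \<omega>\<bar> \<le> K" by (simp add: avgD)
  have [measurable]: "(\<lambda>z. \<integral>w. D z w \<partial>\<mu>) \<in> borel_measurable \<mu>"
    unfolding avgD[symmetric] using tameD_insert[OF tame_avg[OF assms(1)] assms(3)] by simp
  have i1: "integrable \<mu> (\<lambda>z. (\<integral>w. D z w \<partial>\<mu>)\<^sup>2)"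
    using absD by (intro integrable_const_bound[where B = "K\<^sup>2"]) (auto simp: abs_le_square_iff[symmetric] intro: order_trans[OF _ abs_ge_self])
  then show "integrable \<mu> (\<lambda>z. (avg G (insert z \<omega>) - avg G \<omega>)\<^sup>2)"
    by (simp add: avgD)
  have "(\<integral>z. (avg G (insert z \<omega>) - avg G \<omega>)\<^sup>2 \<partial>\<mu>) = (\<integral>z. (\<integral>w. D z w \<partial>\<mu>)\<^sup>2 \<partial>\<mu>)"
    by (simp add: avgD)
  also have "\<dots> \<le> (\<integral>z. (\<integral>w. (D z w)\<^sup>2 \<partial>\<mu>) \<partial>\<mu>)"
    using i1 pair2.integrable_fst'[OF ii] le by (intro integral_mono) auto
  also have "\<dots> = (\<integral>w. (\<integral>z. (D z w)\<^sup>2 \<partial>\<mu>) \<partial>\<mu>)"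
    using ii by (intro pair2.Fubini_integral[symmetric]) (simp add: case_prod_unfold)
  also have "\<dots> \<le> v"
  proof (rule integral_le_const)
    show "integrable \<mu> (\<lambda>w. \<integral>z. (D z w)\<^sup>2 \<partial>\<mu>)"
      using ii by (intro pair2.integrable_snd) (simp add: case_prod_unfold)
    show "AE w in \<mu>. (\<integral>z. (D z w)\<^sup>2 \<partial>\<mu>) \<le> v"
      unfolding D_def using assms(3) by (intro AE_I2 lipD(2)[OF assms(2)]) simp
  qed
  finally show "(\<integral>z. (avg G (insert z \<omega>) - avg G \<omega>)\<^sup>2 \<partial>\<mu>) \<le> v" .
qed

lemma lip_step:
  assumes "tame G" "lip K v G" "0 \<le> p" "p \<le> 1"
  shows "lip K v (step p G)"
  unfolding lip_def
proof (intro conjI allI impI)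
  fix \<omega> :: "'x set" assume \<omega>: "finite \<omega>"
  note L = lip_avg_square[OF assms(1,2) \<omega>]
  let ?a = "\<lambda>z. G (insert z \<omega>) - G \<omega>" and ?b = "\<lambda>z. avg G (insert z \<omega>) - avg G \<omega>"
  have eq: "step p G (insert z \<omega>) - step p G \<omega> = (1 - p) * ?a z + p * ?b z" for z
    by (simp add: step_def algebra_simps)
  show "\<bar>step p G (insert z \<omega>) - step p G \<omega>\<bar> \<le> K" for z
  proof -
    have "\<bar>(1 - p) * ?a z + p * ?b z\<bar> \<le> (1 - p) * \<bar>?a z\<bar> + p * \<bar>?b z\<bar>"
      using assms(3,4) abs_triangle_ineq[of "(1 - p) * ?a z" "p * ?b z"] by (simp add: abs_mult)
    also have "\<dots> \<le> (1 - p) * K + p * K"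
      using lipD(1)[OF assms(2) \<omega>, of z] L(3)[of z] assms(3,4) by (intro add_mono mult_left_mono) auto
    finally show ?thesis unfolding eq by (simp add: algebra_simps)
  qed
  have conv: "((1 - p) * x + p * y)\<^sup>2 \<le> (1 - p) * x\<^sup>2 + p * y\<^sup>2" for x y :: real
  proof -
    have "(1 - p) * x\<^sup>2 + p * y\<^sup>2 - ((1 - p) * x + p * y)\<^sup>2 = p * (1 - p) * (x - y)\<^sup>2"
      by (simp add: power2_eq_square algebra_simps)
    also have "\<dots> \<ge> 0" using assms(3,4) by simp
    finally show ?thesis by linarith
  qed
  note i1 = integrable_increment(2)[OF assms(1,2) \<omega>] and i2 = L(2)
  have "(\<integral>z. (step p G (insert z \<omega>) - step p G \<omega>)\<^sup>2 \<partial>\<mu>) \<le> (\<integral>z. (1 - p) * (?a z)\<^sup>2 + p * (?b z)\<^sup>2 \<partial>\<mu>)"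
  proof (rule integral_mono')
    show "integrable \<mu> (\<lambda>z. (1 - p) * (?a z)\<^sup>2 + p * (?b z)\<^sup>2)"
      using i1 i2 by (intro Bochner_Integration.integrable_add integrable_mult_right)
  qed (unfold eq, auto simp: assms(3,4) intro!: conv)
  also have "\<dots> = (1 - p) * (\<integral>z. (?a z)\<^sup>2 \<partial>\<mu>) + p * (\<integral>z. (?b z)\<^sup>2 \<partial>\<mu>)"
    using i1 i2 by simp
  also have "\<dots> \<le> (1 - p) * v + p * v"
    using lipD(2)[OF assms(2) \<omega>] L(1) assms(3,4) by (intro add_mono mult_left_mono) auto
  finally show "(\<integral>z. (step p G (insert z \<omega>) - step p G \<omega>)\<^sup>2 \<partial>\<mu>) \<le> v"
    by (simp add: algebra_simps)
qed

text \<open>In the second order bound for exp (s D), the linear term, averaged and weighted by p, is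
  exactly s (\<open>step p G\<close> - G), and the mean of D^2 is at most v. Then 1 + u <= exp u
  closes the estimate.\<close>

lemma step_exp_le:
  assumes G: "tame G" "lip K v G" and "K > 0" "s > 0" "0 \<le> p" "p \<le> 1" "finite \<omega>"
  shows "step p (\<lambda>\<omega>. exp (s * G \<omega>)) \<omega>
    \<le> exp (s * step p G \<omega> + p * (v * ((exp (s * K) - 1 - s * K) / K\<^sup>2)))"
proof -
  define \<psi> where "\<psi> = (exp (s * K) - 1 - s * K) / K\<^sup>2"
  have \<psi>: "\<psi> \<ge> 0"
    unfolding \<psi>_def using exp_ge_add_one_self[of "s * K"] by (intro divide_nonneg_nonneg; linarith?) simp
  let ?D = "\<lambda>z. G (insert z \<omega>) - G \<omega>"
  have pt: "exp (s * ?D z) \<le> 1 + s * ?D z + (?D z)\<^sup>2 * \<psi>" for z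
  proof -
    have "\<bar>s * ?D z\<bar> \<le> s * K"
      using lipD(1)[OF G(2) assms(7), of z] \<open>s > 0\<close> by (simp add: abs_mult)
    then have "exp (s * ?D z) - 1 - s * ?D z \<le> (s * ?D z)\<^sup>2 * ((exp (s * K) - 1 - s * K) / (s * K)\<^sup>2)"
      using assms by (intro exp_sub_quadratic_le) auto
    also have "\<dots> = (?D z)\<^sup>2 * \<psi>"
      using assms by (simp add: \<psi>_def power_mult_distrib)
    finally show ?thesis by linarith
  qed
  note i1 = integrable_increment(1)[OF G assms(7)] and i2 = integrable_increment(2)[OF G assms(7)]
  have te: "tame (\<lambda>\<omega>. exp (s * G \<omega>))"
    using G \<open>s > 0\<close> by (intro tame_exp[where K = K] lipD(1)) (auto simp: tame_def)
  have e: "exp (s * G (insert z \<omega>)) = exp (s * G \<omega>) * exp (s * ?D z)" for z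
    by (simp add: exp_add[symmetric] algebra_simps)
  have "avg (\<lambda>\<omega>. exp (s * G \<omega>)) \<omega> \<le> (\<integral>z. exp (s * G \<omega>) * (1 + s * ?D z + (?D z)\<^sup>2 * \<psi>) \<partial>\<mu>)"
    unfolding avg_def
  proof (rule integral_mono)
    show "integrable \<mu> (\<lambda>z. exp (s * G \<omega>) * (1 + s * ?D z + (?D z)\<^sup>2 * \<psi>))"
      using i1 i2 by (intro integrable_mult_right Bochner_Integration.integrable_add integrable_mult_left) auto
    show "exp (s * G (insert z \<omega>)) \<le> exp (s * G \<omega>) * (1 + s * ?D z + (?D z)\<^sup>2 * \<psi>)" for z
      unfolding e using pt by (intro mult_left_mono) auto
  qed (rule tame_integrable_insert[OF te assms(7)])
  also have "\<dots> = exp (s * G \<omega>) * (1 + s * (\<integral>z. ?D z \<partial>\<mu>) + (\<integral>z. (?D z)\<^sup>2 \<partial>\<mu>) * \<psi>)"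
  proof -
    have "(\<integral>z. 1 + s * a z + b z * \<psi> \<partial>\<mu>) = 1 + s * (\<integral>z. a z \<partial>\<mu>) + (\<integral>z. b z \<partial>\<mu>) * \<psi>"
      if "integrable \<mu> a" "integrable \<mu> b" for a b :: "'x \<Rightarrow> real"
      using that by (simp add: prob_space)
    from this[OF i1 i2]
    have "(\<integral>z. 1 + s * ?D z + (?D z)\<^sup>2 * \<psi> \<partial>\<mu>)
        = 1 + s * (\<integral>z. ?D z \<partial>\<mu>) + (\<integral>z. (?D z)\<^sup>2 \<partial>\<mu>) * \<psi>" .
    then show ?thesis by (simp only: integral_mult_right_zero)
  qed
  also have "\<dots> \<le> exp (s * G \<omega>) * (1 + s * (\<integral>z. ?D z \<partial>\<mu>) + v * \<psi>)"
    using lipD(2)[OF G(2) assms(7)] \<psi> by (intro mult_left_mono add_left_mono mult_right_mono) auto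
  finally have "step p (\<lambda>\<omega>. exp (s * G \<omega>)) \<omega>
      \<le> (1 - p) * exp (s * G \<omega>) + p * (exp (s * G \<omega>) * (1 + s * (\<integral>z. ?D z \<partial>\<mu>) + v * \<psi>))"
    unfolding step_def using assms by (intro add_left_mono mult_left_mono) auto
  also have "\<dots> = exp (s * G \<omega>) * (1 + (p * s * (\<integral>z. ?D z \<partial>\<mu>) + p * (v * \<psi>)))"
    by (simp add: algebra_simps)
  also have "\<dots> \<le> exp (s * G \<omega>) * exp (p * s * (\<integral>z. ?D z \<partial>\<mu>) + p * (v * \<psi>))"
    by (intro mult_left_mono exp_ge_add_one_self) auto
  also have "\<dots> = exp (s * step p G \<omega> + p * (v * \<psi>))"
    unfolding step_def avg_eq_increment[OF G(1) assms(7)] by (simp add: exp_add[symmetric] algebra_simps)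
  finally show ?thesis unfolding \<psi>_def .
qed

text \<open>The one-step inequality is applied to the innermost step, its constant factor passes
  outside, and what remains concerns \<open>step p G\<close>, which obeys the same bounds by
  \<open>lip_step\<close>. Hence the induction over all \<open>G\<close>.\<close>

lemma step_funpow_exp_le:
  assumes "tame G" "lip K v G" and "K > 0" "s > 0" "0 \<le> p" "p \<le> 1" "finite \<omega>"
  shows "(step p ^^ M) (\<lambda>\<omega>. exp (s * G \<omega>)) \<omega>
    \<le> exp (s * (step p ^^ M) G \<omega> + real M * (p * (v * ((exp (s * K) - 1 - s * K) / K\<^sup>2))))"
  using assms(1,2)
proof (induction M arbitrary: G)
  case 0
  then show ?case by simp
next
  case (Suc M)
  define c where "c = p * (v * ((exp (s * K) - 1 - s * K) / K\<^sup>2))"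
  have te: "tame (\<lambda>\<omega>. exp (s * H \<omega>))" if "tame H" "lip K v H" for H
    using that \<open>s > 0\<close> by (intro tame_exp[where K = K] lipD(1)) (auto simp: tame_def)
  note S = tame_step[OF Suc.prems(1), of p] lip_step[OF Suc.prems assms(5,6)]
  have "(step p ^^ Suc M) (\<lambda>\<omega>. exp (s * G \<omega>)) \<omega> = (step p ^^ M) (step p (\<lambda>\<omega>. exp (s * G \<omega>))) \<omega>"
    by (simp only: funpow_Suc_right comp_def)
  also have "\<dots> \<le> (step p ^^ M) (\<lambda>\<omega>. exp c * exp (s * step p G \<omega>)) \<omega>"
  proof (rule step_funpow_mono)
    show "tame (step p (\<lambda>\<omega>. exp (s * G \<omega>)))"
      by (rule tame_step[OF te[OF Suc.prems]])
    show "tame (\<lambda>\<omega>. exp c * exp (s * step p G \<omega>))"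
      using tame_lincomb[OF te[OF S] te[OF S], of "exp c" 0] by simp
    show "step p (\<lambda>\<omega>. exp (s * G \<omega>)) \<omega> \<le> exp c * exp (s * step p G \<omega>)" if "finite \<omega>" for \<omega>
      using step_exp_le[OF Suc.prems assms(3-6) that] by (simp add: c_def exp_add mult.commute)
  qed (use assms in auto)
  also have "\<dots> = exp c * (step p ^^ M) (\<lambda>\<omega>. exp (s * step p G \<omega>)) \<omega>"
    by (simp only: step_funpow_cmult)
  also have "\<dots> \<le> exp c * exp (s * (step p ^^ M) (step p G) \<omega> + real M * c)"
    using Suc.IH[OF S] unfolding c_def by (intro mult_left_mono) auto
  also have "\<dots> = exp (s * (step p ^^ Suc M) G \<omega> + real (Suc M) * c)"
    by (simp only: funpow_Suc_right comp_def) (simp add: exp_add[symmetric] algebra_simps)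
  finally show ?case unfolding c_def .
qed

section \<open>A Poisson number of i.i.d. points as a limit of Bernoulli steps\<close>

definition poisson_seq :: "real \<Rightarrow> (nat \<times> 'x stream) measure" where
  "poisson_seq \<Lambda> = measure_pmf (poisson_pmf \<Lambda>) \<Otimes>\<^sub>M stream_space \<mu>"

lemma prob_space_poisson_seq: "prob_space (poisson_seq \<Lambda>)"
proof -
  interpret P: prob_space "measure_pmf (poisson_pmf \<Lambda>)" by (rule prob_space_measure_pmf)
  interpret Q: pair_prob_space "measure_pmf (poisson_pmf \<Lambda>)" "stream_space \<mu>" ..
  show ?thesis unfolding poisson_seq_def by (rule Q.P.prob_space_axioms)
qed

lemma measurable_poisson_seq:
  assumes "\<And>k. (\<lambda>X. f (k, X)) \<in> measurable (stream_space \<mu>) N"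
  shows "f \<in> measurable (poisson_seq \<Lambda>) N"
proof -
  have "f \<in> measurable (count_space UNIV \<Otimes>\<^sub>M stream_space \<mu>) N"
    using assms by (intro measurable_pair_measure_countable1) auto
  then show ?thesis
    unfolding poisson_seq_def by (subst measurable_cong_sets[OF sets_pair_measure_cong refl]) auto
qed

lemma nn_integral_poisson_seq:
  assumes "\<Lambda> > 0" "\<And>k. (\<lambda>X. f (k, X)) \<in> borel_measurable (stream_space \<mu>)"
  shows "(\<integral>\<^sup>+y. f y \<partial>poisson_seq \<Lambda>)
    = (\<Sum>k. ennreal (\<Lambda> ^ k / fact k * exp (- \<Lambda>)) * (\<integral>\<^sup>+X. f (k, X) \<partial>stream_space \<mu>))"
proof -
  have "(\<integral>\<^sup>+y. f y \<partial>poisson_seq \<Lambda>) = (\<integral>\<^sup>+k. (\<integral>\<^sup>+X. f (k, X) \<partial>stream_space \<mu>) \<partial>measure_pmf (poisson_pmf \<Lambda>))"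
    using measurable_poisson_seq[of f borel \<Lambda>] assms(2) unfolding poisson_seq_def
    by (subst seq.nn_integral_fst[symmetric]) auto
  also have "\<dots> = (\<Sum>k. ennreal (\<Lambda> ^ k / fact k * exp (- \<Lambda>)) * (\<integral>\<^sup>+X. f (k, X) \<partial>stream_space \<mu>))"
    using assms(1) by (simp add: nn_integral_measure_pmf nn_integral_count_space_nat)
  finally show ?thesis .
qed

text \<open>A prefix of length k has at most k distinct points, so one geometric bound serves the
  values along the stream and, after integration, the iterated averages.\<close>

lemma avg_funpow_bound:
  assumes "tame f"
  obtains C a where "C \<ge> 0" "a \<ge> 1" "\<And>k. \<bar>(avg ^^ k) f {}\<bar> \<le> C * a ^ k"
    "\<And>k X. \<bar>f (set (stake k X))\<bar> \<le> C * a ^ k"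
proof -
  obtain C a where *: "C \<ge> 0" "a \<ge> 1" "\<And>\<omega> k. finite \<omega> \<Longrightarrow> card \<omega> \<le> k \<Longrightarrow> \<bar>f \<omega>\<bar> \<le> C * a ^ k"
    using tameD_bound[OF assms] by metis
  have b: "\<bar>f (set (stake k X))\<bar> \<le> C * a ^ k" for k X
    using card_length[of "stake k X"] by (intro *) auto
  have i: "integrable (stream_space \<mu>) (\<lambda>X. f (set (stake k X)))" for k
    using tame_integrable_union[OF assms, of "{}" k] by simp
  have "\<bar>(avg ^^ k) f {}\<bar> \<le> C * a ^ k" for k
  proof -
    have "(\<integral>X. f (set (stake k X)) \<partial>stream_space \<mu>) \<le> C * a ^ k"
      using b[of k] by (intro seq.integral_le_const i AE_I2) (auto simp: abs_le_iff)
    moreover have "- (C * a ^ k) \<le> (\<integral>X. f (set (stake k X)) \<partial>stream_space \<mu>)"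
      using b[of k] by (intro seq.integral_ge_const i AE_I2) (auto simp: abs_le_iff minus_le_iff)
    ultimately show ?thesis
      using avg_funpow_eq_integral[OF assms, of "{}" k] by (simp add: abs_le_iff minus_le_iff)
  qed
  with * b show ?thesis using that by blast
qed

lemma summable_poisson_weight: "summable (\<lambda>k. \<Lambda> ^ k / fact k * (C * a ^ k))" for \<Lambda> C a :: real
proof -
  have "summable (\<lambda>k. C * ((\<Lambda> * a) ^ k / fact k))"
    using summable_exp[of "\<Lambda> * a"] by (intro summable_mult) (simp add: divide_inverse mult.commute)
  then show ?thesis by (simp add: power_mult_distrib mult_ac)
qed

text \<open>The Poisson law has exponential moments of all orders, so geometric growth in the number
  of points is integrable.\<close>

lemma poisson_seq_tame:
  assumes "\<Lambda> > 0" "tame f"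
  shows "integrable (poisson_seq \<Lambda>) (\<lambda>(k, X). f (set (stake k X)))"
    and "(\<integral>(k, X). f (set (stake k X)) \<partial>poisson_seq \<Lambda>)
      = (\<Sum>k. \<Lambda> ^ k / fact k * exp (- \<Lambda>) * (avg ^^ k) f {})"
proof -
  interpret P: prob_space "measure_pmf (poisson_pmf \<Lambda>)" by (rule prob_space_measure_pmf)
  interpret Q: pair_prob_space "measure_pmf (poisson_pmf \<Lambda>)" "stream_space \<mu>" ..
  obtain C a where *: "C \<ge> 0" "a \<ge> 1" "\<And>k. \<bar>(avg ^^ k) f {}\<bar> \<le> C * a ^ k"
    "\<And>k X. \<bar>f (set (stake k X))\<bar> \<le> C * a ^ k"
    using avg_funpow_bound[OF assms(2)] by metis
  have fm: "(\<lambda>X. f (set (stake k X))) \<in> borel_measurable (stream_space \<mu>)" for k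
    using assms(2) unfolding tame_def by blast
  let ?f = "\<lambda>(k, X). f (set (stake k X))"
  have m: "?f \<in> borel_measurable (poisson_seq \<Lambda>)"
    by (rule measurable_poisson_seq) (simp add: fm)
  have summ: "summable (\<lambda>k. \<Lambda> ^ k / fact k * exp (- \<Lambda>) * (C * a ^ k))"
    using summable_mult[OF summable_poisson_weight[of \<Lambda> C a], of "exp (- \<Lambda>)"] by (simp add: mult_ac)
  have "(\<integral>\<^sup>+y. ennreal (norm (?f y)) \<partial>poisson_seq \<Lambda>)
      = (\<Sum>k. ennreal (\<Lambda> ^ k / fact k * exp (- \<Lambda>)) * (\<integral>\<^sup>+X. ennreal \<bar>f (set (stake k X))\<bar> \<partial>stream_space \<mu>))"
    using assms(1) fm by (subst nn_integral_poisson_seq) auto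
  also have "\<dots> \<le> (\<Sum>k. ennreal (\<Lambda> ^ k / fact k * exp (- \<Lambda>) * (C * a ^ k)))"
  proof (intro suminf_le)
    fix k
    have "(\<integral>\<^sup>+X. ennreal \<bar>f (set (stake k X))\<bar> \<partial>stream_space \<mu>) \<le> (\<integral>\<^sup>+X. ennreal (C * a ^ k) \<partial>stream_space \<mu>)"
      using * by (intro nn_integral_mono ennreal_leI) auto
    also have "\<dots> = ennreal (C * a ^ k)" by (simp add: seq.emeasure_space_1)
    finally have "ennreal (\<Lambda> ^ k / fact k * exp (- \<Lambda>)) * (\<integral>\<^sup>+X. ennreal \<bar>f (set (stake k X))\<bar> \<partial>stream_space \<mu>)
        \<le> ennreal (\<Lambda> ^ k / fact k * exp (- \<Lambda>)) * ennreal (C * a ^ k)"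
      by (rule mult_left_mono) simp
    also have "\<dots> = ennreal (\<Lambda> ^ k / fact k * exp (- \<Lambda>) * (C * a ^ k))"
      using assms(1) * by (intro ennreal_mult[symmetric]) auto
    finally show "ennreal (\<Lambda> ^ k / fact k * exp (- \<Lambda>)) * (\<integral>\<^sup>+X. ennreal \<bar>f (set (stake k X))\<bar> \<partial>stream_space \<mu>)
        \<le> ennreal (\<Lambda> ^ k / fact k * exp (- \<Lambda>) * (C * a ^ k))" .
  qed auto
  also have "\<dots> < \<infinity>"
    using assms(1) * by (subst suminf_ennreal2[OF _ summ]) auto
  finally show i: "integrable (poisson_seq \<Lambda>) ?f"
    using m by (intro integrableI_bounded) auto
  have avg_eq: "(\<integral>X. f (set (stake k X)) \<partial>stream_space \<mu>) = (avg ^^ k) f {}" for k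
    using avg_funpow_eq_integral[OF assms(2), of "{}" k] by simp
  have "(\<integral>y. ?f y \<partial>poisson_seq \<Lambda>) = (\<integral>k. (avg ^^ k) f {} \<partial>measure_pmf (poisson_pmf \<Lambda>))"
    using Q.integral_fst'[of ?f] i by (simp add: poisson_seq_def avg_eq)
  also have "\<dots> = (\<integral>k. \<Lambda> ^ k / fact k * exp (- \<Lambda>) * (avg ^^ k) f {} \<partial>count_space UNIV)"
    using assms(1) by (subst measure_pmf_eq_density) (simp add: integral_density)
  also have "\<dots> = (\<Sum>k. \<Lambda> ^ k / fact k * exp (- \<Lambda>) * (avg ^^ k) f {})"
  proof (intro integral_count_space_nat)
    have "summable (\<lambda>k. norm (\<Lambda> ^ k / fact k * exp (- \<Lambda>) * (avg ^^ k) f {}))"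
    proof (rule summable_comparison_test'[OF summ])
      show "norm (norm (\<Lambda> ^ k / fact k * exp (- \<Lambda>) * (avg ^^ k) f {})) \<le> \<Lambda> ^ k / fact k * exp (- \<Lambda>) * (C * a ^ k)" for k
        using mult_left_mono[OF *(3)[of k], of "\<Lambda> ^ k / fact k * exp (- \<Lambda>)"] assms(1) by (simp add: abs_mult)
    qed
    then show "integrable (count_space UNIV) (\<lambda>k. \<Lambda> ^ k / fact k * exp (- \<Lambda>) * (avg ^^ k) f {})"
      by (simp add: integrable_count_space_nat_iff)
  qed
  finally show "(\<integral>y. ?f y \<partial>poisson_seq \<Lambda>)
      = (\<Sum>k. \<Lambda> ^ k / fact k * exp (- \<Lambda>) * (avg ^^ k) f {})" .
qed

text \<open>Dominated convergence for series. The binomial sum is written over all k, its terms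
  beyond M being zero, so that it can be compared termwise with the Poisson series.\<close>

lemma step_funpow_tendsto_poisson:
  assumes "\<Lambda> > 0" "tame f"
  shows "(\<lambda>M. (step (\<Lambda> / real M) ^^ M) f {}) \<longlonglongrightarrow> (\<integral>(k, X). f (set (stake k X)) \<partial>poisson_seq \<Lambda>)"
proof -
  obtain C a where *: "C \<ge> 0" "a \<ge> 1" "\<And>k. \<bar>(avg ^^ k) f {}\<bar> \<le> C * a ^ k"
    using avg_funpow_bound[OF assms(2)] by metis
  define b where "b k M = real (M choose k) * (\<Lambda> / real M) ^ k * (1 - \<Lambda> / real M) ^ (M - k) * (avg ^^ k) f {}" for k M
  have ev: "eventually (\<lambda>M. \<Lambda> \<le> real M \<and> M > 0) sequentially"
    using eventually_gt_at_top[of "nat \<lceil>\<Lambda>\<rceil>"] by eventually_elim linarith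
  have "norm (b k M) \<le> \<Lambda> ^ k / fact k * (C * a ^ k)" if "\<Lambda> \<le> real M \<and> M > 0" for k M
  proof -
    have "real (M choose k) * (\<Lambda> / real M) ^ k * (1 - \<Lambda> / real M) ^ (M - k) \<ge> 0"
      using that assms(1) by (intro mult_nonneg_nonneg zero_le_power) auto
    then have "norm (b k M) = real (M choose k) * (\<Lambda> / real M) ^ k * (1 - \<Lambda> / real M) ^ (M - k) * \<bar>(avg ^^ k) f {}\<bar>"
      unfolding b_def real_norm_def abs_mult[of _ "(avg ^^ k) f {}"] by (simp only: abs_of_nonneg)
    also have "\<dots> \<le> \<Lambda> ^ k / fact k * (C * a ^ k)"
      using that assms(1) *(3) by (intro mult_mono binomial_weight_le) auto
    finally show ?thesis .
  qed
  then have bd: "eventually (\<lambda>(k, M). norm (b k M) \<le> \<Lambda> ^ k / fact k * (C * a ^ k)) (at_top \<times>\<^sub>F sequentially)"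
    unfolding case_prod_unfold
    by (intro eventually_mono[OF eventually_prodI[OF always_eventually ev, of "\<lambda>_. True"]]) auto
  have "(\<lambda>M. \<Sum>k. b k M) \<longlonglongrightarrow> (\<Sum>k. \<Lambda> ^ k / fact k * exp (- \<Lambda>) * (avg ^^ k) f {})"
  proof (rule tannerys_theorem[THEN conjunct2, THEN conjunct2])
    show "(\<lambda>M. b k M) \<longlonglongrightarrow> \<Lambda> ^ k / fact k * exp (- \<Lambda>) * (avg ^^ k) f {}" for k
      unfolding b_def using assms(1) by (intro tendsto_mult_right binomial_weight_tendsto) simp
  qed (use bd summable_poisson_weight in auto)
  also have "(\<lambda>M. \<Sum>k. b k M) = (\<lambda>M. (step (\<Lambda> / real M) ^^ M) f {})"
  proof
    fix M
    have "(\<Sum>k. b k M) = (\<Sum>k\<le>M. b k M)"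
      by (rule suminf_finite) (auto simp: b_def binomial_eq_0)
    then show "(\<Sum>k. b k M) = (step (\<Lambda> / real M) ^^ M) f {}"
      unfolding b_def by (subst step_funpow_eq_binomial[OF assms(2)]) simp_all
  qed
  finally show ?thesis by (simp only: poisson_seq_tame(2)[OF assms])
qed

text \<open>With p = \<Lambda> / M the M steps accumulate M p = \<Lambda>, so the error term in the
  exponent is the same for all large M; in the limit only the binomial means change into Poisson
  means.\<close>

theorem poisson_seq_exp_le:
  assumes "\<Lambda> > 0" "tame G" "lip K v G" "K > 0" "s > 0"
  shows "(\<integral>(k, X). exp (s * G (set (stake k X))) \<partial>poisson_seq \<Lambda>)
    \<le> exp (s * (\<integral>(k, X). G (set (stake k X)) \<partial>poisson_seq \<Lambda>)
        + \<Lambda> * v * ((exp (s * K) - 1 - s * K) / K\<^sup>2))"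
proof -
  define c where "c = v * ((exp (s * K) - 1 - s * K) / K\<^sup>2)"
  have te: "tame (\<lambda>\<omega>. exp (s * G \<omega>))"
    using assms by (intro tame_exp[where K = K] lipD(1)) (auto simp: tame_def)
  let ?p = "\<lambda>M. \<Lambda> / real M"
  have "eventually (\<lambda>M. (step (?p M) ^^ M) (\<lambda>\<omega>. exp (s * G \<omega>)) {}
      \<le> exp (s * (step (?p M) ^^ M) G {} + \<Lambda> * c)) sequentially"
    using eventually_gt_at_top[of "nat \<lceil>\<Lambda>\<rceil>"]
  proof eventually_elim
    case (elim M)
    then have M: "\<Lambda> \<le> real M" "M > 0" by linarith+
    have "(step (?p M) ^^ M) (\<lambda>\<omega>. exp (s * G \<omega>)) {}
        \<le> exp (s * (step (?p M) ^^ M) G {} + real M * (?p M * c))"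
      unfolding c_def using M assms by (intro step_funpow_exp_le) auto
    then show ?case using M by simp
  qed
  moreover have "(\<lambda>M. exp (s * (step (?p M) ^^ M) G {} + \<Lambda> * c))
      \<longlonglongrightarrow> exp (s * (\<integral>(k, X). G (set (stake k X)) \<partial>poisson_seq \<Lambda>) + \<Lambda> * c)"
    by (intro tendsto_exp tendsto_add tendsto_mult tendsto_const step_funpow_tendsto_poisson[OF assms(1,2)])
  ultimately have "(\<integral>(k, X). exp (s * G (set (stake k X))) \<partial>poisson_seq \<Lambda>)
      \<le> exp (s * (\<integral>(k, X). G (set (stake k X)) \<partial>poisson_seq \<Lambda>) + \<Lambda> * c)"
    using tendsto_le[OF sequentially_bot _ step_funpow_tendsto_poisson[OF assms(1) te]] by blast
  then show ?thesis unfolding c_def by (simp add: mult.assoc)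
qed

section \<open>Void probabilities of the explicit model\<close>

lemma pred_stake_disjoint:
  assumes [measurable]: "D \<in> sets \<mu>"
  shows "Measurable.pred (stream_space \<mu>) (\<lambda>X. set (stake k X) \<inter> D = {})"
proof (induction k)
  case 0
  then show ?case by simp
next
  case (Suc k)
  have [measurable]: "Measurable.pred (stream_space \<mu>) (\<lambda>X. set (stake k (stl X)) \<inter> D = {})"
    by (rule measurable_compose[OF measurable_stl Suc])
  have "Measurable.pred (stream_space \<mu>) (\<lambda>X. shd X \<notin> D \<and> set (stake k (stl X)) \<inter> D = {})"
    by measurable
  then show ?case by simp
qed

text \<open>The void indicator is an eigenfunction of \<open>avg\<close>: the added point misses
  \<open>D\<close> with probability 1 - \<mu>(D), independently of the points already
  present.\<close>

lemma avg_funpow_void: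
  assumes "D \<in> sets \<mu>"
  shows "(avg ^^ k) (\<lambda>\<omega>. if \<omega> \<inter> D = {} then 1 else 0) \<omega>
    = (1 - measure \<mu> D) ^ k * (if \<omega> \<inter> D = {} then 1 else 0)"
proof (induction k arbitrary: \<omega>)
  case 0
  then show ?case by simp
next
  case (Suc k)
  have "(avg ^^ Suc k) (\<lambda>\<omega>. if \<omega> \<inter> D = {} then 1 else 0) \<omega>
      = (\<integral>z. (1 - measure \<mu> D) ^ k * (if insert z \<omega> \<inter> D = {} then 1 else 0) \<partial>\<mu>)"
    unfolding funpow.simps comp_def avg_def[of "(avg ^^ k) _"] Suc ..
  also have "\<dots> = (\<integral>z. (1 - measure \<mu> D) ^ k * (if \<omega> \<inter> D = {} then 1 else 0) * indicator (space \<mu> - D) z \<partial>\<mu>)"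
    by (intro Bochner_Integration.integral_cong) (auto simp: space_UNIV indicator_def)
  also have "\<dots> = (1 - measure \<mu> D) ^ Suc k * (if \<omega> \<inter> D = {} then 1 else 0)"
    using prob_compl[OF assms] by (simp add: Int_absorb2)
  finally show ?case .
qed

lemma poisson_seq_void:
  assumes "D \<in> sets \<mu>" "\<Lambda> > 0"
  shows "measure (poisson_seq \<Lambda>) {y \<in> space (poisson_seq \<Lambda>). set (stake (fst y) (snd y)) \<inter> D = {}}
    = exp (- (\<Lambda> * measure \<mu> D))"
proof -
  let ?f = "\<lambda>\<omega>. if \<omega> \<inter> D = {} then 1 else 0 :: real"
  have [measurable]: "Measurable.pred (stream_space \<mu>) (\<lambda>X. set (stake k X) \<inter> D = {})" for k
    by (rule pred_stake_disjoint[OF assms(1)])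
  have tame: "tame ?f"
  proof (rule tame_mono_bound)
    show "(\<lambda>X. ?f (set (stake k X))) \<in> borel_measurable (stream_space \<mu>)" for k
      by measurable
    show "(1::real) \<ge> 1" "(1::real) \<ge> 0" by simp_all
    show "\<bar>?f \<omega>\<bar> \<le> 1 * 1 ^ card \<omega>" for \<omega> by simp
  qed
  have "measure (poisson_seq \<Lambda>) {y \<in> space (poisson_seq \<Lambda>). set (stake (fst y) (snd y)) \<inter> D = {}}
      = (\<integral>y. indicator {y \<in> space (poisson_seq \<Lambda>). set (stake (fst y) (snd y)) \<inter> D = {}} y \<partial>poisson_seq \<Lambda>)"
    by (simp add: Int_absorb2)
  also have "\<dots> = (\<integral>(k, X). ?f (set (stake k X)) \<partial>poisson_seq \<Lambda>)"
    by (intro Bochner_Integration.integral_cong) (simp_all add: indicator_def case_prod_unfold)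
  also have "\<dots> = (\<Sum>k. \<Lambda> ^ k / fact k * exp (- \<Lambda>) * (1 - measure \<mu> D) ^ k)"
    using poisson_seq_tame(2)[OF assms(2) tame] by (simp add: avg_funpow_void[OF assms(1)])
  also have "\<dots> = exp (- (\<Lambda> * measure \<mu> D))"
  proof (rule sums_unique[symmetric])
    have "(\<lambda>k. \<Lambda> ^ k / fact k * exp (- \<Lambda>) * c ^ k) sums exp (\<Lambda> * c - \<Lambda>)" for c
    proof -
      have "(\<lambda>k. exp (- \<Lambda>) * ((\<Lambda> * c) ^ k /\<^sub>R fact k)) sums (exp (- \<Lambda>) * exp (\<Lambda> * c))"
        by (intro sums_mult exp_converges)
      then show ?thesis
        by (simp add: exp_add[symmetric] power_mult_distrib divide_inverse mult_ac)
    qed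
    from this[of "1 - measure \<mu> D"]
    show "(\<lambda>k. \<Lambda> ^ k / fact k * exp (- \<Lambda>) * (1 - measure \<mu> D) ^ k) sums exp (- (\<Lambda> * measure \<mu> D))"
      by (simp add: right_diff_distrib)
  qed
  finally show ?thesis .
qed

end

section \<open>Void probabilities determine the law\<close>

lemma configurations_subset:
  assumes "A \<in> configurations" "B \<subseteq> A"
  shows "B \<in> configurations"
  unfolding configurations_def
proof (intro CollectI conjI allI impI)
  show "countable B"
    using assms countable_subset unfolding configurations_def by blast
  fix K :: "'a set" assume "compact K"
  then have "finite (A \<inter> K)" using assms(1) unfolding configurations_def by blast
  then show "finite (B \<inter> K)" by (rule rev_finite_subset) (use assms(2) in blast)
qed

lemma configurations_Int: "A \<in> configurations \<Longrightarrow> A \<inter> S \<in> configurations"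
  by (rule configurations_subset) auto

lemma finite_configurations: "finite A \<Longrightarrow> A \<in> configurations"
  unfolding configurations_def by (simp add: countable_finite)

lemma space_config_space: "space config_space = configurations"
  unfolding config_space_def by (rule space_measure_of) blast

lemma config_count_measurable:
  assumes "B \<in> sets borel"
  shows "config_count B \<in> borel_measurable config_space"
proof (rule measurableI)
  fix A :: "ennreal set" assume "A \<in> sets borel"
  then have "config_count B -` A \<inter> configurations \<in> {config_count B -` A \<inter> configurations | A B. A \<in> sets borel \<and> B \<in> sets borel}"
    using assms by blast
  then show "config_count B -` A \<inter> space config_space \<in> sets config_space"
    unfolding space_config_space unfolding config_space_def by (rule in_measure_of[rotated]) auto
qed simp

lemma config_count_eq_0_iff: "config_count B \<omega> = 0 \<longleftrightarrow> \<omega> \<inter> B = {}"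
  unfolding config_count_def by (auto simp: emeasure_count_space_eq_0)

lemma void_event_sets:
  assumes "B \<in> sets borel"
  shows "{\<omega> \<in> configurations. \<omega> \<inter> B = {}} \<in> sets config_space"
proof -
  have "config_count B -` {0} \<inter> space config_space \<in> sets config_space"
    using config_count_measurable[OF assms] by (rule measurable_sets) simp
  moreover have "config_count B -` {0} \<inter> space config_space = {\<omega> \<in> configurations. \<omega> \<inter> B = {}}"
    unfolding space_config_space vimage_def by (simp add: config_count_eq_0_iff Int_def conj_commute)
  ultimately show ?thesis by simp
qed

lemma poisson_law_void:
  assumes "poisson_law \<nu> Q" "B \<in> sets borel" "emeasure \<nu> B < \<infinity>"
  shows "emeasure Q {\<omega> \<in> configurations. \<omega> \<inter> B = {}} = ennreal (exp (- measure \<nu> B))"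
proof -
  interpret Q: prob_space Q using assms(1) by (simp add: poisson_law_def)
  have "sets Q = sets config_space" using assms(1) by (simp add: poisson_law_def)
  then have sp: "space Q = configurations"
    using sets_eq_imp_space_eq space_config_space by metis
  have "measure Q {\<omega>\<in>space Q. config_count B \<omega> = of_nat 0}
      = exp (- measure \<nu> B) * measure \<nu> B ^ 0 / fact 0"
    using assms(1)[unfolded poisson_law_def, THEN conjunct2, THEN conjunct2, THEN conjunct1] assms(2,3)
    by (simp only: simp_thms)
  then show ?thesis
    by (simp add: Q.emeasure_eq_measure sp config_count_eq_0_iff)
qed

text \<open>The dissecting system: \<^term>\<open>cell_code U n\<close> maps a point to the cell containing it in the
  partition generated by the first \<^term>\<open>n\<close> sets.\<close>

definition cell_code :: "(nat \<Rightarrow> 'a set) \<Rightarrow> nat \<Rightarrow> 'a \<Rightarrow> nat set" where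
  "cell_code U n x = {i. i < n \<and> x \<in> U i}"

lemma inj_on_cell_code:
  assumes "finite B" "\<And>x y. x \<in> B \<Longrightarrow> y \<in> B \<Longrightarrow> x \<noteq> y \<Longrightarrow> \<exists>i. x \<in> U i \<and> y \<notin> U i"
  shows "\<exists>n. inj_on (cell_code U n) B"
proof -
  define f where "f x y = (LEAST i. x \<in> U i \<and> y \<notin> U i)" for x y
  have f: "x \<in> U (f x y) \<and> y \<notin> U (f x y)" if "x \<in> B" "y \<in> B" "x \<noteq> y" for x y
    unfolding f_def using assms(2)[OF that] by (rule LeastI_ex)
  \<comment> \<open>One more than the largest index separating a pair. The diagonal pairs contribute
    an arbitrary value, which can only enlarge \<open>n\<close>.\<close>
  define n where "n = Suc (Max (case_prod f ` (B \<times> B)))"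
  have n: "f x y < n" if "x \<in> B" "y \<in> B" for x y
    unfolding n_def using assms(1) that by (intro le_imp_less_Suc Max_ge) auto
  have "inj_on (cell_code U n) B"
  proof (rule inj_onI, rule ccontr)
    fix x y assume xy: "x \<in> B" "y \<in> B" "cell_code U n x = cell_code U n y" "x \<noteq> y"
    have "f x y \<in> cell_code U n x" "f x y \<notin> cell_code U n y"
      using f[OF xy(1,2,4)] n[OF xy(1,2)] by (auto simp: cell_code_def)
    with xy(3) show False by simp
  qed
  then show ?thesis by blast
qed

text \<open>Charged cells never outnumber points, and any finite subset of \<open>A\<close>
  eventually occupies distinct cells. Working with finite subsets also settles infinite
  \<open>A\<close>.\<close>

lemma emeasure_count_space_eq_SUP_cell_code:
  assumes "\<And>x y. x \<in> A \<Longrightarrow> y \<in> A \<Longrightarrow> x \<noteq> y \<Longrightarrow> \<exists>i. x \<in> U i \<and> y \<notin> U i"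
  shows "emeasure (count_space UNIV) A = (SUP n. of_nat (card (cell_code U n ` A)) :: ennreal)"
proof (rule antisym)
  have fin: "finite (cell_code U n ` A)" for n
    by (rule finite_subset[of _ "Pow {..<n}"]) (auto simp: cell_code_def)
  have sub: "of_nat (card B) \<le> (SUP n. of_nat (card (cell_code U n ` A)) :: ennreal)" if "finite B" "B \<subseteq> A" for B
  proof -
    obtain n where "inj_on (cell_code U n) B"
      using inj_on_cell_code[OF \<open>finite B\<close>, of U] assms \<open>B \<subseteq> A\<close> by blast
    then have "card B = card (cell_code U n ` B)" by (simp add: card_image)
    also have "\<dots> \<le> card (cell_code U n ` A)" using that by (intro card_mono fin) auto
    finally show ?thesis by (intro SUP_upper2[of n]) auto
  qed
  show "emeasure (count_space UNIV) A \<le> (SUP n. of_nat (card (cell_code U n ` A)))"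
  proof (cases "finite A")
    case True
    then show ?thesis using sub[of A] by simp
  next
    case False
    have "of_nat k \<le> (SUP n. of_nat (card (cell_code U n ` A)) :: ennreal)" for k
      using infinite_arbitrarily_large[OF False, of k] sub by blast
    then have "(SUP n. of_nat (card (cell_code U n ` A)) :: ennreal) = \<top>"
      by (metis ennreal_Ex_less_of_nat linorder_not_le top.not_eq_extremum)
    then show ?thesis by (metis top_greatest)
  qed
  show "(SUP n. of_nat (card (cell_code U n ` A)) :: ennreal) \<le> emeasure (count_space UNIV) A"
  proof (cases "finite A")
    case True
    then show ?thesis by (intro SUP_least) (auto intro: card_image_le)
  qed simp
qed

section \<open>Void events on a product of configuration spaces\<close>

definition void_events :: "'i set \<Rightarrow> ('i \<Rightarrow> 'a::topological_space set) set set" where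
  "void_events I = {{\<omega> \<in> I \<rightarrow>\<^sub>E configurations. \<forall>i\<in>I. \<omega> i \<inter> B i = {}} | B. \<forall>i\<in>I. B i \<in> sets borel}"

text \<open>The sigma-algebra on which void probabilities determine the law directly.
  \<open>confine_measurable\<close> is the passage from it to the counts that generate
  \<open>config_space\<close>.\<close>

definition void_space :: "'i set \<Rightarrow> ('i \<Rightarrow> 'a::topological_space set) measure" where
  "void_space I = sigma (I \<rightarrow>\<^sub>E configurations) (void_events I)"

lemma void_events_Pow: "void_events I \<subseteq> Pow (I \<rightarrow>\<^sub>E configurations)"
  unfolding void_events_def by blast

lemma space_void_space: "space (void_space I) = (I \<rightarrow>\<^sub>E configurations)"
  unfolding void_space_def using void_events_Pow by (rule space_measure_of)

lemma sets_void_space: "sets (void_space I) = sigma_sets (I \<rightarrow>\<^sub>E configurations) (void_events I)"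
  unfolding void_space_def using void_events_Pow by (rule sets_measure_of)

text \<open>Intersecting two void boxes unites their sets coordinatewise, so the boxes form a
  pi-system.\<close>

lemma Int_stable_void_events:
  "Int_stable (void_events I :: ('i \<Rightarrow> 'a::topological_space set) set set)"
proof (rule Int_stableI)
  fix a b :: "('i \<Rightarrow> 'a set) set" assume "a \<in> void_events I" "b \<in> void_events I"
  then obtain B C where *: "a = {\<omega> \<in> I \<rightarrow>\<^sub>E configurations. \<forall>i\<in>I. \<omega> i \<inter> B i = {}}" "\<forall>i\<in>I. B i \<in> sets borel"
    "b = {\<omega> \<in> I \<rightarrow>\<^sub>E configurations. \<forall>i\<in>I. \<omega> i \<inter> C i = {}}" "\<forall>i\<in>I. C i \<in> sets borel"
    unfolding void_events_def by blast
  have "a \<inter> b = {\<omega> \<in> I \<rightarrow>\<^sub>E configurations. \<forall>i\<in>I. \<omega> i \<inter> (B i \<union> C i) = {}}"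
    unfolding *(1,3) Int_Un_distrib Un_empty by blast
  moreover have "\<forall>i\<in>I. B i \<union> C i \<in> sets borel" using *(2,4) by auto
  ultimately show "a \<inter> b \<in> void_events I"
    unfolding void_events_def by (intro CollectI exI[of _ "\<lambda>i. B i \<union> C i"] conjI)
qed

lemma void_space_single:
  assumes "i \<in> I" "D \<in> sets borel"
  shows "{\<omega> \<in> space (void_space I). \<omega> i \<inter> D = {}} \<in> sets (void_space I)"
proof -
  have "{\<omega> \<in> I \<rightarrow>\<^sub>E configurations. \<forall>j\<in>I. \<omega> j \<inter> (if j = i then D else {}) = {}} \<in> void_events I"
    unfolding void_events_def using assms(2)
    by (intro CollectI exI[of _ "\<lambda>j. if j = i then D else {}"]) simp
  also have "{\<omega> \<in> I \<rightarrow>\<^sub>E configurations. \<forall>j\<in>I. \<omega> j \<inter> (if j = i then D else {}) = {}}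
      = {\<omega> \<in> space (void_space I). \<omega> i \<inter> D = {}}"
  proof -
    have "(\<forall>j\<in>I. \<omega> j \<inter> (if j = i then D else {}) = {}) \<longleftrightarrow> \<omega> i \<inter> D = {}" for \<omega>
      using assms(1) by (metis inf_bot_right)
    then show ?thesis by (simp only: space_void_space)
  qed
  finally show ?thesis
    unfolding sets_void_space by (rule sigma_sets.Basic)
qed

text \<open>Discarding the points outside \<open>S\<close> makes all configurations separated, and
  changes a Poisson configuration only on a null event when \<open>S\<close> has full
  intensity.\<close>

definition confine :: "'a set \<Rightarrow> 'i set \<Rightarrow> ('i \<Rightarrow> 'a set) \<Rightarrow> 'i \<Rightarrow> 'a set" where
  "confine S I \<omega> = (\<lambda>i\<in>I. \<omega> i \<inter> S)"

text \<open>On a set whose points are separated by countably many Borel sets, the number of points in a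
  Borel set is the limit of the number of charged cells of the dissecting system.  This is why void
  events determine all counts.\<close>

lemma confine_measurable:
  fixes S :: "'a::topological_space set"
  assumes S: "S \<in> sets borel" and U: "\<And>n. U n \<in> sets borel"
    and sep: "\<And>x y. x \<in> S \<Longrightarrow> y \<in> S \<Longrightarrow> x \<noteq> y \<Longrightarrow> \<exists>i::nat. x \<in> U i \<and> y \<notin> U i"
  shows "confine S I \<in> measurable (void_space I) (PiM I (\<lambda>_. config_space))"
proof (rule measurable_PiM_single')
  show "confine S I \<in> space (void_space I) \<rightarrow> (\<Pi>\<^sub>E i\<in>I. space config_space)"
    by (auto simp: confine_def space_void_space space_config_space PiE_iff intro!: configurations_Int)
  fix i assume i: "i \<in> I"
  \<comment> \<open>A code contained in {..<n} selects a finite Boolean combination of the sets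
    \<open>U j\<close>; any other code selects the empty cell.\<close>
  have cell: "{x. cell_code U n x = c} \<in> sets borel" for n c
  proof (cases "c \<subseteq> {..<n}")
    case True
    then have "{x. cell_code U n x = c} = {x \<in> space borel. \<forall>j\<in>{..<n}. (x \<in> U j) = (j \<in> c)}"
      unfolding cell_code_def set_eq_iff by auto
    also have "\<dots> \<in> sets borel"
      using U by measurable
    finally show ?thesis .
  next
    case False
    then have "{x. cell_code U n x = c} = {}" by (auto simp: cell_code_def)
    then show ?thesis by simp
  qed
  have cnt: "(\<lambda>\<omega>. config_count B (\<omega> i \<inter> S)) \<in> borel_measurable (void_space I)"
    if B: "B \<in> sets borel" for B
  proof -
    have "config_count B (\<omega> i \<inter> S) = (SUP n. \<Sum>c\<in>Pow {..<n}.
        if \<omega> i \<inter> (S \<inter> B \<inter> {x. cell_code U n x = c}) = {} then 0 else 1)" for \<omega>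
    proof -
      let ?A = "\<omega> i \<inter> S \<inter> B"
      have c: "of_nat (card (cell_code U n ` ?A)) = (\<Sum>c\<in>Pow {..<n}.
          if \<omega> i \<inter> (S \<inter> B \<inter> {x. cell_code U n x = c}) = {} then 0 else (1::ennreal))" for n
      proof -
        have "cell_code U n ` ?A = {c \<in> Pow {..<n}. \<omega> i \<inter> (S \<inter> B \<inter> {x. cell_code U n x = c}) \<noteq> {}}"
          by (auto simp: cell_code_def)
        then have "of_nat (card (cell_code U n ` ?A))
            = (\<Sum>c\<in>{c \<in> Pow {..<n}. \<omega> i \<inter> (S \<inter> B \<inter> {x. cell_code U n x = c}) \<noteq> {}}. 1::ennreal)"
          by simp
        also have "\<dots> = (\<Sum>c\<in>Pow {..<n}.
            if \<omega> i \<inter> (S \<inter> B \<inter> {x. cell_code U n x = c}) = {} then 0 else 1)"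
          by (subst sum.inter_filter) (auto intro!: sum.cong)
        finally show ?thesis .
      qed
      have "config_count B (\<omega> i \<inter> S) = (SUP n. of_nat (card (cell_code U n ` ?A)))"
        unfolding config_count_def using sep by (intro emeasure_count_space_eq_SUP_cell_code) auto
      then show ?thesis by (simp only: c)
    qed
    moreover have "Measurable.pred (void_space I) (\<lambda>\<omega>. \<omega> i \<inter> (S \<inter> B \<inter> {x. cell_code U n x = c}) = {})" for n c
      unfolding pred_def using S B cell i by (intro void_space_single) auto
    ultimately show ?thesis by simp
  qed
  have "(\<lambda>\<omega>. \<omega> i \<inter> S) \<in> measurable (void_space I) config_space"
    unfolding config_space_def
  proof (rule measurable_measure_of)
    show "(\<lambda>\<omega>. \<omega> i \<inter> S) \<in> space (void_space I) \<rightarrow> configurations"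
      using i by (auto simp: space_void_space intro: configurations_Int)
    fix y :: "'a set set" assume "y \<in> {config_count B -` A \<inter> configurations | A B. A \<in> sets borel \<and> B \<in> sets borel}"
    then obtain A B where y: "y = config_count B -` A \<inter> configurations" "A \<in> sets borel" "B \<in> sets borel"
      by blast
    have "(\<lambda>\<omega>. \<omega> i \<inter> S) -` y \<inter> space (void_space I) = (\<lambda>\<omega>. config_count B (\<omega> i \<inter> S)) -` A \<inter> space (void_space I)"
      using i by (auto simp: y space_void_space intro: configurations_Int)
    also have "\<dots> \<in> sets (void_space I)"
      using cnt[OF y(3)] y(2) by (rule measurable_sets)
    finally show "(\<lambda>\<omega>. \<omega> i \<inter> S) -` y \<inter> space (void_space I) \<in> sets (void_space I)" .
  qed auto
  then show "(\<lambda>\<omega>. confine S I \<omega> i) \<in> measurable (void_space I) config_space"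
    using i by (simp add: confine_def)
qed

section \<open>Identification of the product law with the marked model\<close>

definition unmark :: "'i set \<Rightarrow> ('i \<times> 'a) set \<Rightarrow> 'i \<Rightarrow> 'a set" where
  "unmark I \<omega> = (\<lambda>i\<in>I. {y. (i, y) \<in> \<omega>})"

text \<open>Reduces a void box of the tuple to a single void event of the marked points, to which
  \<open>poisson_seq_void\<close> applies.\<close>

lemma unmark_void_iff: "(\<forall>i\<in>I. unmark I \<omega> i \<inter> B i = {}) \<longleftrightarrow> \<omega> \<inter> Sigma I B = {}"
  unfolding unmark_def by auto

lemma unmark_configurations: "finite \<omega> \<Longrightarrow> unmark I \<omega> \<in> I \<rightarrow>\<^sub>E configurations"
proof -
  assume "finite \<omega>"
  have "finite {y. (i, y) \<in> \<omega>}" for i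
    using finite_vimageI[OF \<open>finite \<omega>\<close>, of "Pair i"] by (simp add: inj_on_def vimage_def)
  then show ?thesis
    unfolding unmark_def by (simp add: finite_configurations)
qed

text \<open>Both laws give a void box the probability exp (- sum of \<nu>(B i)): the product law by
  independence of the coordinates, the model by \<open>mass\<close>. Uniqueness on the pi-system
  equates them on \<open>void_space\<close>, and \<open>confine\<close> lifts the equality to the
  counts. Repeated points of the stream collapse in the set and are invisible to void
  events.\<close>

lemma poisson_product_eq_distr:
  fixes \<mu> :: "('i \<times> 'a::topological_space) measure"
  assumes ps: "point_source \<mu>" and sets_\<mu>: "sets \<mu> = sets (count_space UNIV \<Otimes>\<^sub>M borel)"
    and I: "finite I" "I \<noteq> {}" and "\<Lambda> > 0"
    and Q: "\<And>i. i \<in> I \<Longrightarrow> poisson_law \<nu> (Q i)"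
    and fin: "emeasure \<nu> UNIV < \<infinity>" and sets_\<nu>: "sets \<nu> = sets borel"
    and S: "S \<in> sets borel" "emeasure \<nu> (- S) = 0"
    and U: "\<And>n. U n \<in> sets borel"
      "\<And>x y. x \<in> S \<Longrightarrow> y \<in> S \<Longrightarrow> x \<noteq> y \<Longrightarrow> \<exists>i::nat. x \<in> U i \<and> y \<notin> U i"
    and mass: "\<And>B. (\<And>i. i \<in> I \<Longrightarrow> B i \<in> sets borel) \<Longrightarrow>
      \<Lambda> * measure \<mu> (Sigma I B) = (\<Sum>i\<in>I. measure \<nu> (B i))"
  shows "PiM I Q = distr (point_source.poisson_seq \<mu> \<Lambda>) (PiM I (\<lambda>_. config_space))
      (\<lambda>(k, X). confine S I (unmark I (set (stake k X))))"
    and "(\<lambda>(k, X). confine S I (unmark I (set (stake k X))))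
      \<in> measurable (point_source.poisson_seq \<mu> \<Lambda>) (PiM I (\<lambda>_. config_space))"
proof -
  interpret point_source \<mu> by (rule ps)
  interpret R: prob_space "poisson_seq \<Lambda>" by (rule prob_space_poisson_seq)
  obtain i0 where i0: "i0 \<in> I" using I by blast
  \<comment> \<open>The locale for product measures asks for a probability measure at every index,
    so a factor is copied outside \<open>I\<close>.\<close>
  define Q' where "Q' i = (if i \<in> I then Q i else Q i0)" for i
  have Q': "poisson_law \<nu> (Q' i)" for i
    using Q i0 by (simp add: Q'_def)
  have PQ: "PiM I Q = PiM I Q'" by (rule PiM_cong) (simp_all add: Q'_def)
  have prob: "prob_space (Q' i)" and sQ: "sets (Q' i) = sets config_space" for i
    using Q'[of i] by (simp_all add: poisson_law_def)
  interpret PP: product_prob_space Q' I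
    by (intro product_prob_spaceI prob)
  let ?C = "PiM I (\<lambda>_. config_space :: 'a set measure)"
  have sP: "sets (PiM I Q') = sets ?C" by (rule sets_PiM_cong[OF refl sQ])
  have spP: "space (PiM I Q') = (I \<rightarrow>\<^sub>E configurations)"
    using sets_eq_imp_space_eq[OF sP] by (simp add: space_PiM space_config_space)
  have void_PiE: "{\<omega> \<in> I \<rightarrow>\<^sub>E configurations. \<forall>i\<in>I. \<omega> i \<inter> B i = {}}
      = (\<Pi>\<^sub>E i\<in>I. {\<omega> \<in> configurations. \<omega> \<inter> B i = {}})" for B :: "'i \<Rightarrow> 'a set"
    unfolding PiE_def Pi_def by blast
  have vs: "{\<omega> \<in> configurations. \<omega> \<inter> B = {}} \<in> sets (Q' i)" if "B \<in> sets borel" for B i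
    using void_event_sets[OF that] by (simp add: sQ)
  have void_sets: "{\<omega> \<in> I \<rightarrow>\<^sub>E configurations. \<forall>i\<in>I. \<omega> i \<inter> B i = {}} \<in> sets (PiM I Q')"
    if "\<forall>i\<in>I. B i \<in> sets borel" for B
    unfolding void_PiE using that I(1) by (intro sets_PiM_I_finite vs) auto
  have void_P: "emeasure (PiM I Q') {\<omega> \<in> I \<rightarrow>\<^sub>E configurations. \<forall>i\<in>I. \<omega> i \<inter> B i = {}}
      = ennreal (exp (- (\<Sum>i\<in>I. measure \<nu> (B i))))" if B: "\<forall>i\<in>I. B i \<in> sets borel" for B
  proof -
    have lt: "emeasure \<nu> (B i) < \<infinity>" for i
      using le_less_trans[OF emeasure_mono[of "B i" UNIV \<nu>] fin] sets_\<nu> by simp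
    have "emeasure (PiM I Q') (\<Pi>\<^sub>E i\<in>I. {\<omega> \<in> configurations. \<omega> \<inter> B i = {}})
        = (\<Prod>i\<in>I. emeasure (Q' i) {\<omega> \<in> configurations. \<omega> \<inter> B i = {}})"
      using I(1) B by (intro PP.emeasure_PiM vs) auto
    also have "\<dots> = (\<Prod>i\<in>I. ennreal (exp (- measure \<nu> (B i))))"
      using B lt by (intro prod.cong refl poisson_law_void[OF Q']) auto
    also have "\<dots> = ennreal (\<Prod>i\<in>I. exp (- measure \<nu> (B i)))"
      by (rule prod_ennreal) simp
    also have "(\<Prod>i\<in>I. exp (- measure \<nu> (B i))) = exp (- (\<Sum>i\<in>I. measure \<nu> (B i)))"
      by (simp add: exp_sum[OF I(1), symmetric] sum_negf)
    finally show ?thesis unfolding void_PiE .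
  qed
  have id_meas: "(\<lambda>\<omega>. \<omega>) \<in> measurable (PiM I Q') (void_space I)"
    unfolding void_space_def
  proof (rule measurable_measure_of[OF void_events_Pow])
    fix y :: "('i \<Rightarrow> 'a set) set" assume "y \<in> void_events I"
    then obtain B where y: "y = {\<omega> \<in> I \<rightarrow>\<^sub>E configurations. \<forall>i\<in>I. \<omega> i \<inter> B i = {}}" "\<forall>i\<in>I. B i \<in> sets borel"
      unfolding void_events_def by blast
    have "(\<lambda>\<omega>. \<omega>) -` y \<inter> space (PiM I Q') = y"
      unfolding spP y(1) by blast
    then show "(\<lambda>\<omega>. \<omega>) -` y \<inter> space (PiM I Q') \<in> sets (PiM I Q')"
      using void_sets[OF y(2)] by (simp only: y(1)[symmetric])
  qed (simp add: spP)
  have Sig: "Sigma I B \<in> sets \<mu>" if "\<forall>i\<in>I. B i \<in> sets borel" for B :: "'i \<Rightarrow> 'a set"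
  proof -
    have "Sigma I B = (\<Union>i\<in>I. {i} \<times> B i)" by blast
    also have "\<dots> \<in> sets (count_space UNIV \<Otimes>\<^sub>M borel)"
      using that I(1) by (intro sets.finite_UN pair_measureI) auto
    finally show ?thesis by (simp only: sets_\<mu>)
  qed
  let ?\<Psi> = "\<lambda>(k, X). unmark I (set (stake k X))"
  have \<Psi>_meas: "?\<Psi> \<in> measurable (poisson_seq \<Lambda>) (void_space I)"
  proof (rule measurable_poisson_seq, unfold prod.case)
    fix k
    show "(\<lambda>X. unmark I (set (stake k X))) \<in> measurable (stream_space \<mu>) (void_space I)"
      unfolding void_space_def
    proof (rule measurable_measure_of[OF void_events_Pow])
      show "(\<lambda>X. unmark I (set (stake k X))) \<in> space (stream_space \<mu>) \<rightarrow> (I \<rightarrow>\<^sub>E configurations)"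
        by (intro funcsetI unmark_configurations) simp
      fix y :: "('i \<Rightarrow> 'a set) set" assume "y \<in> void_events I"
      then obtain B where y: "y = {\<omega> \<in> I \<rightarrow>\<^sub>E configurations. \<forall>i\<in>I. \<omega> i \<inter> B i = {}}" "\<forall>i\<in>I. B i \<in> sets borel"
        unfolding void_events_def by blast
      have "(\<lambda>X. unmark I (set (stake k X))) -` y \<inter> space (stream_space \<mu>)
          = {X \<in> space (stream_space \<mu>). set (stake k X) \<inter> Sigma I B = {}}"
        unfolding y(1) unmark_void_iff[symmetric] by (rule set_eqI) (simp add: unmark_configurations conj_commute)
      also have "\<dots> \<in> sets (stream_space \<mu>)"
        using pred_stake_disjoint[OF Sig[OF y(2)], of k] unfolding pred_def .
      finally show "(\<lambda>X. unmark I (set (stake k X))) -` y \<inter> space (stream_space \<mu>) \<in> sets (stream_space \<mu>)" .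
    qed
  qed
  note conf = confine_measurable[OF S(1) U, of I]
  let ?\<Phi> = "\<lambda>(k, X). confine S I (unmark I (set (stake k X)))"
  have \<Phi>: "?\<Phi> = (\<lambda>y. confine S I (?\<Psi> y))" by (simp add: case_prod_unfold)
  show \<Phi>_meas: "?\<Phi> \<in> measurable (poisson_seq \<Lambda>) ?C"
    unfolding \<Phi> by (rule measurable_compose[OF \<Psi>_meas conf])
  have laws: "distr (PiM I Q') (void_space I) (\<lambda>\<omega>. \<omega>) = distr (poisson_seq \<Lambda>) (void_space I) ?\<Psi>"
  proof (rule measure_eqI_generator_eq[OF Int_stable_void_events void_events_Pow])
    fix y :: "('i \<Rightarrow> 'a set) set" assume yv: "y \<in> void_events I"
    then obtain B where y: "y = {\<omega> \<in> I \<rightarrow>\<^sub>E configurations. \<forall>i\<in>I. \<omega> i \<inter> B i = {}}" "\<forall>i\<in>I. B i \<in> sets borel"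
      unfolding void_events_def by blast
    have ys: "y \<in> sets (void_space I)"
      unfolding sets_void_space by (rule sigma_sets.Basic[OF yv])
    have "(\<lambda>\<omega>. \<omega>) -` y \<inter> space (PiM I Q') = y"
      unfolding spP y(1) by blast
    then have "emeasure (distr (PiM I Q') (void_space I) (\<lambda>\<omega>. \<omega>)) y = emeasure (PiM I Q') y"
      by (simp only: emeasure_distr[OF id_meas ys])
    also have "\<dots> = ennreal (exp (- (\<Lambda> * measure \<mu> (Sigma I B))))"
      unfolding y(1) void_P[OF y(2)] using mass[of B] y(2) by simp
    also have "\<dots> = emeasure (poisson_seq \<Lambda>) {y \<in> space (poisson_seq \<Lambda>). set (stake (fst y) (snd y)) \<inter> Sigma I B = {}}"
      unfolding R.emeasure_eq_measure poisson_seq_void[OF Sig[OF y(2)] \<open>\<Lambda> > 0\<close>] ..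
    also have "{y \<in> space (poisson_seq \<Lambda>). set (stake (fst y) (snd y)) \<inter> Sigma I B = {}}
        = ?\<Psi> -` y \<inter> space (poisson_seq \<Lambda>)"
      unfolding y(1) unmark_void_iff[symmetric] case_prod_unfold
      by (rule set_eqI) (simp add: unmark_configurations conj_commute)
    also have "emeasure (poisson_seq \<Lambda>) \<dots> = emeasure (distr (poisson_seq \<Lambda>) (void_space I) ?\<Psi>) y"
      by (rule emeasure_distr[OF \<Psi>_meas ys, symmetric])
    finally show "emeasure (distr (PiM I Q') (void_space I) (\<lambda>\<omega>. \<omega>)) y
        = emeasure (distr (poisson_seq \<Lambda>) (void_space I) ?\<Psi>) y" .
  next
    \<comment> \<open>The whole space is the void box with empty sets; as a constant sequence it
      serves as the exhaustion by sets of finite measure.\<close>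
    show "range (\<lambda>_::nat. I \<rightarrow>\<^sub>E configurations) \<subseteq> (void_events I :: ('i \<Rightarrow> 'a set) set set)"
      unfolding void_events_def by (intro image_subsetI CollectI exI[of _ "\<lambda>_. {}"]) simp
    show "(\<Union>_::nat. I \<rightarrow>\<^sub>E configurations) = (I \<rightarrow>\<^sub>E (configurations :: 'a set set))" by simp
    show "emeasure (distr (PiM I Q') (void_space I) (\<lambda>\<omega>. \<omega>)) (I \<rightarrow>\<^sub>E configurations) \<noteq> \<infinity>"
      using finite_measure.emeasure_finite[OF prob_space.axioms(1)[OF prob_space.prob_space_distr[OF prob_space_PiM[OF prob] id_meas]]] by simp
  qed (simp_all add: sets_void_space)
  \<comment> \<open>The void probability of the null set \<open>- S\<close> is exp 0 = 1.\<close>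
  have AE_Q: "AE \<omega> in Q' i. \<omega> \<subseteq> S" for i
  proof -
    have "measure \<nu> (- S) = 0" using S(2) by (simp add: measure_def)
    then have e1: "emeasure (Q' i) {\<omega> \<in> configurations. \<omega> \<inter> - S = {}} = 1"
      using poisson_law_void[OF Q', of "- S" i] S by simp
    have "AE \<omega> in Q' i. \<omega> \<in> {\<omega> \<in> configurations. \<omega> \<inter> - S = {}}"
      using e1 by (intro prob_space.AE_prob_1[OF prob]) (simp add: measure_def)
    then show ?thesis by eventually_elim blast
  qed
  have "AE \<omega> in PiM I Q'. \<forall>i\<in>I. \<omega> i \<subseteq> S"
    using I(1) AE_PiM_component[of I Q', OF prob _ AE_Q] by (intro AE_finite_allI) auto
  then have AE_id: "AE \<omega> in PiM I Q'. \<omega> = confine S I \<omega>"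
    using AE_space
  proof eventually_elim
    case (elim \<omega>)
    have "\<omega> i = confine S I \<omega> i" for i
      using elim unfolding confine_def spP by (cases "i \<in> I") (auto simp: PiE_def extensional_def)
    then show ?case by blast
  qed
  have id_conf: "confine S I \<in> measurable (PiM I Q') ?C"
    using measurable_compose[OF id_meas conf] .
  have "PiM I Q' = distr (PiM I Q') (PiM I Q') (\<lambda>\<omega>. \<omega>)" by (rule distr_id[symmetric])
  also have "\<dots> = distr (PiM I Q') ?C (confine S I)"
    using AE_id id_conf by (intro distr_cong_AE) (auto simp: sP cong: measurable_cong_sets)
  also have "\<dots> = distr (distr (PiM I Q') (void_space I) (\<lambda>\<omega>. \<omega>)) ?C (confine S I)"
    by (rule distr_distr[OF conf id_meas, unfolded comp_def, symmetric])
  also have "\<dots> = distr (poisson_seq \<Lambda>) ?C ?\<Phi>"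
    unfolding laws \<Phi> by (rule distr_distr[OF conf \<Psi>_meas, unfolded comp_def])
  finally show "PiM I Q = distr (poisson_seq \<Lambda>) ?C ?\<Phi>" unfolding PQ .
qed

section \<open>Radon measures\<close>

lemma radon_sets: "radon \<nu> \<Longrightarrow> sets \<nu> = sets borel"
  by (simp add: radon_def)

lemma radon_inner: "radon \<nu> \<Longrightarrow> B \<in> sets borel \<Longrightarrow>
    emeasure \<nu> B = (SUP K\<in>{K. compact K \<and> K \<subseteq> B}. emeasure \<nu> K)"
  by (simp add: radon_def)

lemma radon_compact_finite: "radon \<nu> \<Longrightarrow> compact K \<Longrightarrow> emeasure \<nu> K < \<infinity>"
  by (simp add: radon_def)

text \<open>The complement of the support is covered by open null sets, possibly uncountably many.
  Each compact subset needs finitely many of them, and inner regularity passes from compact sets to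
  the complement of \<open>C\<close>.\<close>

lemma radon_null_outside_support:
  fixes \<nu> :: "'a::t2_space measure"
  assumes \<nu>: "radon \<nu>" and "measure_support \<nu> \<subseteq> C" "C \<in> sets borel"
  shows "emeasure \<nu> (- C) = 0"
proof -
  have "emeasure \<nu> K = 0" if K: "compact K" "K \<subseteq> - C" for K
  proof -
    let ?N = "{U. open U \<and> emeasure \<nu> U = 0}"
    have "K \<subseteq> \<Union>?N"
    proof
      fix y assume "y \<in> K"
      then have "y \<notin> measure_support \<nu>" using K(2) assms(2) by blast
      then obtain U where "open U" "y \<in> U" "\<not> emeasure \<nu> U > 0"
        unfolding measure_support_def by blast
      then show "y \<in> \<Union>?N" by (auto simp: zero_less_iff_neq_zero)
    qed
    then obtain D where D: "D \<subseteq> ?N" "finite D" "K \<subseteq> \<Union>D"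
      using compactE[OF K(1), of ?N] by (metis (no_types, lifting) mem_Collect_eq)
    have "emeasure \<nu> (\<Union>U\<in>D. U) \<le> (\<Sum>U\<in>D. emeasure \<nu> U)"
      using D \<nu> by (intro emeasure_subadditive_finite) (auto simp: radon_sets)
    also have "\<dots> = 0" using D by (intro sum.neutral) blast
    finally have "emeasure \<nu> (\<Union>D) = 0" by simp
    moreover have "\<Union>D \<in> sets \<nu>"
      using D \<nu> by (intro sets.finite_Union) (auto simp: radon_sets)
    ultimately show ?thesis
      using emeasure_mono[OF D(3), of \<nu>] by (simp add: radon_sets[OF \<nu>])
  qed
  then have "emeasure \<nu> (- C) \<le> 0"
    unfolding radon_inner[OF \<nu> borel_comp[OF assms(3)]] by (intro SUP_least) simp
  then show ?thesis by simp
qed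

lemma radon_compact_approx:
  fixes \<nu> :: "'a::t2_space measure"
  assumes \<nu>: "radon \<nu>" and B: "B \<in> sets borel" "emeasure \<nu> B < \<infinity>" and "e > 0"
  obtains K where "compact K" "K \<subseteq> B" "emeasure \<nu> B \<le> emeasure \<nu> K + ennreal e"
\<comment> \<open>Subtracting e strictly decreases the extended mass only if that mass is positive;
  a null \<open>B\<close> is served by the empty compact set.\<close>
proof (cases "emeasure \<nu> B = 0")
  case True
  then show ?thesis using that[of "{}"] by simp
next
  case False
  have "emeasure \<nu> B - ennreal e < emeasure \<nu> B"
    using False B(2) assms(4) by (intro ennreal_between) (auto simp: zero_less_iff_neq_zero)
  then have "\<exists>K\<in>{K. compact K \<and> K \<subseteq> B}. emeasure \<nu> B - ennreal e < emeasure \<nu> K"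
    by (subst (asm) (2) radon_inner[OF \<nu> B(1)]) (simp only: less_SUP_iff)
  then obtain K where "compact K" "K \<subseteq> B" "emeasure \<nu> B - ennreal e < emeasure \<nu> K" by blast
  then show ?thesis
    using that[of K] by (metis add.commute ennreal_minus_le_iff less_imp_le)
qed

text \<open>A compact set may be assembled from compact pieces in the shells around the origin, so local
  finiteness at the origin excludes infinite total mass.\<close>

lemma compact_shells:
  fixes K :: "nat \<Rightarrow> 'a::real_normed_vector set"
  assumes "\<And>k. compact (K k)" "\<And>k. K k \<subseteq> cball 0 (r k)" "r \<longlonglongrightarrow> 0"
  shows "compact (insert 0 (\<Union>k. K k))"
proof (rule Topological_Spaces.compactI)
  fix C assume C: "\<forall>t\<in>C. open t" "insert 0 (\<Union>k. K k) \<subseteq> \<Union>C"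
  \<comment> \<open>The member of the cover that contains 0 swallows all but finitely many of the
    sets \<open>K k\<close>.\<close>
  then obtain t where t: "t \<in> C" "0 \<in> t" "open t" by blast
  then obtain e where e: "e > 0" "ball 0 e \<subseteq> t" using openE by blast
  have "eventually (\<lambda>k. r k < e) sequentially"
    using assms(3) e(1) by (rule order_tendstoD)
  then obtain N where N: "\<And>k. k \<ge> N \<Longrightarrow> r k < e"
    by (auto simp: eventually_sequentially)
  have "compact (\<Union>k\<in>{..<N}. K k)" using assms(1) by (intro compact_UN) auto
  moreover have "(\<Union>k\<in>{..<N}. K k) \<subseteq> \<Union>C" using C(2) by blast
  ultimately obtain D where D: "D \<subseteq> C" "finite D" "(\<Union>k\<in>{..<N}. K k) \<subseteq> \<Union>D"
    using C(1) compactE by metis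
  have "K k \<subseteq> \<Union>(insert t D)" for k
  proof (cases "k < N")
    case True
    then show ?thesis using D(3) by blast
  next
    case False
    have "x \<in> t" if "x \<in> K k" for x
    proof -
      have "norm x < e" using assms(2)[of k] that N[of k] False by (auto simp: dist_norm not_less)
      then show ?thesis using e(2) by (auto simp: dist_norm)
    qed
    then show ?thesis by blast
  qed
  then have "insert 0 (\<Union>k. K k) \<subseteq> \<Union>(insert t D)"
    using t(2) by blast
  then show "\<exists>C'\<subseteq>C. finite C' \<and> insert 0 (\<Union>k. K k) \<subseteq> \<Union>C'"
    using t(1) D by (intro exI[of _ "insert t D"]) auto
qed

text \<open>Markov's inequality bounds the mass away from 0. Near 0 there may be no compact
  neighbourhood, so each shell \<open>A k\<close> is approximated by a compact \<open>K k\<close>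
  with error (1/2)^k. All \<open>K k\<close> together with 0 form one compact set, of finite mass,
  and the shells exceed it by at most 2 in total.\<close>

lemma radon_finite_of_second_moment:
  fixes \<nu> :: "'a::real_normed_vector measure"
  assumes \<nu>: "radon \<nu>" and int: "integrable \<nu> (\<lambda>y. (norm y)\<^sup>2)"
  shows "emeasure \<nu> UNIV < \<infinity>"
proof -
  have sp: "space \<nu> = UNIV" using sets_eq_imp_space_eq[OF radon_sets[OF \<nu>]] by simp
  note [simp] = radon_sets[OF \<nu>]
  have tail: "emeasure \<nu> {y. norm y > e} < \<infinity>" if "e > 0" for e
  proof -
    have "emeasure \<nu> {y \<in> space \<nu>. (norm y)\<^sup>2 \<ge> e\<^sup>2} < \<infinity>"
      using int that by (intro le_less_trans[OF integral_Markov_inequality]) auto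
    moreover have "emeasure \<nu> {y. norm y > e} \<le> emeasure \<nu> {y \<in> space \<nu>. (norm y)\<^sup>2 \<ge> e\<^sup>2}"
      using that by (intro emeasure_mono) (auto simp: sp intro!: power_mono)
    ultimately show ?thesis by (rule le_less_trans[rotated])
  qed
  define r where "r k = 1 / real (Suc k)" for k
  define A where "A k = {y::'a. r (Suc k) < norm y \<and> norm y \<le> r k}" for k
  have rpos: "r k > 0" for k by (simp add: r_def)
  have r0: "r \<longlonglongrightarrow> 0" unfolding r_def by (rule LIMSEQ_inverse_real_of_nat[unfolded inverse_eq_divide])
  have A_sets: "A k \<in> sets borel" for k
    unfolding A_def by measurable
  have A_fin: "emeasure \<nu> (A k) < \<infinity>" for k
    using le_less_trans[OF emeasure_mono tail[OF rpos[of "Suc k"]], of "A k"] by (auto simp: A_def)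
  have "\<exists>K. compact K \<and> K \<subseteq> A k \<and> emeasure \<nu> (A k) \<le> emeasure \<nu> K + ennreal ((1/2) ^ k)" for k
    using radon_compact_approx[OF \<nu> A_sets A_fin, of "(1/2) ^ k" k] by (metis zero_less_power half_gt_zero zero_less_one)
  then obtain K where K: "\<And>k. compact (K k)" "\<And>k. K k \<subseteq> A k"
    "\<And>k. emeasure \<nu> (A k) \<le> emeasure \<nu> (K k) + ennreal ((1/2) ^ k)"
    by metis
  have "compact (insert 0 (\<Union>k. K k))"
    using K(1,2) r0 by (intro compact_shells[of K r]) (auto simp: A_def dist_norm subset_iff)
  from radon_compact_finite[OF \<nu> this] have finK: "emeasure \<nu> (insert 0 (\<Union>k. K k)) < \<infinity>" .
  have r_mono: "r l \<le> r k" if "k \<le> l" for k l using that by (simp add: r_def frac_le)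
  have disjA: "disjoint_family A"
  proof (unfold disjoint_family_on_def, intro ballI impI)
    have *: "A k \<inter> A l = {}" if "k < l" for k l
      using r_mono[of "Suc k" l] that by (auto simp: A_def)
    show "A m \<inter> A n = {}" if "m \<noteq> n" for m n
      using that *[of m n] *[of n m] by (cases "m < n") auto
  qed
  have disjK: "disjoint_family K"
    using disjA K(2) unfolding disjoint_family_on_def by blast
  have "(\<Sum>k. emeasure \<nu> (K k)) = emeasure \<nu> (\<Union>k. K k)"
    using disjK borel_closed[OF compact_imp_closed[OF K(1)]] by (intro suminf_emeasure) auto
  also have "\<dots> \<le> emeasure \<nu> (insert 0 (\<Union>k. K k))"
  proof (intro emeasure_mono)
    show "insert 0 (\<Union>k. K k) \<in> sets \<nu>"
      using compact_imp_closed[OF \<open>compact (insert 0 (\<Union>k. K k))\<close>] by simp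
  qed auto
  finally have sumK: "(\<Sum>k. emeasure \<nu> (K k)) < \<infinity>" using finK by (rule le_less_trans)
  have "(\<Sum>k. emeasure \<nu> (A k)) \<le> (\<Sum>k. emeasure \<nu> (K k) + ennreal ((1/2) ^ k))"
    using K(3) by (intro suminf_le) auto
  also have "\<dots> = (\<Sum>k. emeasure \<nu> (K k)) + (\<Sum>k. ennreal ((1/2) ^ k))"
    by (rule suminf_add[symmetric]) auto
  also have "(\<Sum>k. ennreal ((1/2) ^ k)) = ennreal 2"
    by (subst suminf_ennreal2) (auto simp: suminf_geometric)
  also have "(\<Sum>k. emeasure \<nu> (K k)) + ennreal 2 < \<infinity>" using sumK by (simp add: less_top)
  finally have sumA: "emeasure \<nu> (\<Union>k. A k) < \<infinity>"
    using suminf_emeasure[OF _ disjA, of \<nu>] A_sets by (simp add: image_subset_iff)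
  have "UNIV \<subseteq> {y. norm y > 1} \<union> (\<Union>k. A k) \<union> {0::'a}"
  proof
    fix y :: 'a
    have "y \<in> (\<Union>k. A k)" if "y \<noteq> 0" "norm y \<le> 1"
    proof -
      have "eventually (\<lambda>k. r k < norm y) sequentially"
        using r0 that(1) by (intro order_tendstoD) auto
      then have ex: "\<exists>k. r k < norm y" by (auto simp: eventually_sequentially)
      \<comment> \<open>The shell of \<open>y\<close> ends at the first radius below
        \<open>norm y\<close>; that index is positive because r 0 = 1.\<close>
      define k where "k = (LEAST k. r k < norm y)"
      have k: "r k < norm y" unfolding k_def using ex by (rule LeastI_ex)
      have "k \<noteq> 0" using k that(2) by (intro notI) (simp add: r_def)
      then obtain j where j: "k = Suc j" by (cases k) auto
      have "\<not> r j < norm y" using not_less_Least[of j "\<lambda>k. r k < norm y"] j by (simp add: k_def[symmetric])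
      with k j show ?thesis by (auto simp: A_def)
    qed
    then show "y \<in> {y. norm y > 1} \<union> (\<Union>k. A k) \<union> {0}" by force
  qed
  then have "emeasure \<nu> UNIV \<le> emeasure \<nu> ({y. norm y > 1} \<union> (\<Union>k. A k) \<union> {0})"
    using A_sets by (intro emeasure_mono sets.Un) auto
  also have "\<dots> \<le> emeasure \<nu> ({y. norm y > 1} \<union> (\<Union>k. A k)) + emeasure \<nu> {0}"
    using A_sets by (intro emeasure_subadditive sets.Un) auto
  also have "\<dots> \<le> emeasure \<nu> {y. norm y > 1} + emeasure \<nu> (\<Union>k. A k) + emeasure \<nu> {0}"
    using A_sets by (intro add_right_mono emeasure_subadditive) auto
  also have "\<dots> < \<infinity>"
    using tail[of 1] sumA radon_compact_finite[OF \<nu>, of "{0}"] by (simp add: less_top)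
  finally show ?thesis .
qed

lemma radon_sigma_compact:
  fixes \<nu> :: "'a::t2_space measure"
  assumes \<nu>: "radon \<nu>" and B: "B \<in> sets borel" "emeasure \<nu> B < \<infinity>"
  obtains K :: "nat \<Rightarrow> 'a set"
  where "\<And>k. compact (K k)" "(\<Union>k. K k) \<subseteq> B" "emeasure \<nu> (B - (\<Union>k. K k)) = 0"
proof -
  note [simp] = radon_sets[OF \<nu>]
  have "\<exists>K. compact K \<and> K \<subseteq> B \<and> emeasure \<nu> B \<le> emeasure \<nu> K + ennreal (1 / real (Suc k))" for k
    using radon_compact_approx[OF \<nu> B, of "1 / real (Suc k)"] by (metis of_nat_0_less_iff zero_less_Suc zero_less_divide_1_iff)
  then obtain K where K: "\<And>k. compact (K k)" "\<And>k. K k \<subseteq> B"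
    "\<And>k. emeasure \<nu> B \<le> emeasure \<nu> (K k) + ennreal (1 / real (Suc k))"
    by metis
  have Ks: "K k \<in> sets \<nu>" for k using compact_imp_closed[OF K(1)] by simp
  let ?S = "\<Union>k. K k"
  have S: "?S \<in> sets \<nu>" using Ks by blast
  have eq: "emeasure \<nu> B = emeasure \<nu> ?S"
  proof (rule antisym)
    have "emeasure \<nu> B \<le> emeasure \<nu> ?S + ennreal (1 / real (Suc k))" for k
      using emeasure_mono[of "K k" ?S \<nu>] S by (intro order_trans[OF K(3)[of k]] add_right_mono) auto
    moreover have "(\<lambda>k. emeasure \<nu> ?S + ennreal (1 / real (Suc k))) \<longlonglongrightarrow> emeasure \<nu> ?S + ennreal 0"
      using LIMSEQ_inverse_real_of_nat by (intro tendsto_add tendsto_const tendsto_ennrealI) (simp add: inverse_eq_divide)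
    ultimately show "emeasure \<nu> B \<le> emeasure \<nu> ?S"
      by (intro LIMSEQ_le_const) auto
    show "emeasure \<nu> ?S \<le> emeasure \<nu> B" using K(2) B by (intro emeasure_mono) auto
  qed
  have "emeasure \<nu> (B - ?S) = emeasure \<nu> B - emeasure \<nu> ?S"
    using S B K(2) eq by (intro emeasure_Diff) auto
  then have "emeasure \<nu> (B - ?S) = 0" using eq B(2) by simp
  with K show ?thesis using that[of K] by blast
qed

text \<open>Total boundedness gives finite nets of each \<open>K j\<close> at every scale 1/(m + 1),
  hence countably many balls in all. A ball containing x with radius below half of dist x y cannot
  contain y.\<close>

lemma sigma_compact_separating:
  fixes K :: "nat \<Rightarrow> 'a::metric_space set"
  assumes "\<And>k. compact (K k)"
  obtains U :: "nat \<Rightarrow> 'a set" where "\<And>n. open (U n)"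
    "\<And>x y. x \<in> (\<Union>k. K k) \<Longrightarrow> x \<noteq> y \<Longrightarrow> \<exists>n. x \<in> U n \<and> y \<notin> U n"
proof -
  have "\<exists>C. finite C \<and> K j \<subseteq> (\<Union>c\<in>C. ball c (1 / real (Suc m)))" for j m
    using assms[of j] unfolding compact_eq_totally_bounded
    by (metis of_nat_0_less_iff zero_less_Suc zero_less_divide_1_iff)
  then obtain C where C: "\<And>j m. finite (C j m)" "\<And>j m. K j \<subseteq> (\<Union>c\<in>C j m. ball c (1 / real (Suc m)))"
    by metis
  \<comment> \<open>The empty set keeps the family nonempty, as its enumeration by
    \<open>from_nat_into\<close> requires.\<close>
  define \<U> where "\<U> = insert {} (\<Union>j. \<Union>m. (\<lambda>c. ball c (1 / real (Suc m))) ` C j m)"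
  have cnt: "countable \<U>" unfolding \<U>_def
    using C(1) by (intro countable_insert countable_UN) (auto intro: countable_finite)
  have ne: "\<U> \<noteq> {}" unfolding \<U>_def by simp
  have op: "open (from_nat_into \<U> n)" for n
    using from_nat_into[OF ne, of n] unfolding \<U>_def by auto
  have "\<exists>n. x \<in> from_nat_into \<U> n \<and> y \<notin> from_nat_into \<U> n"
    if x: "x \<in> (\<Union>k. K k)" and "x \<noteq> y" for x y
  proof -
    obtain j where j: "x \<in> K j" using x by blast
    obtain m where m: "1 / real (Suc m) < dist x y / 2"
      using nat_approx_posE[of "dist x y / 2"] \<open>x \<noteq> y\<close> by auto
    obtain c where c: "c \<in> C j m" "x \<in> ball c (1 / real (Suc m))" using C(2) j by blast
    then have "dist x y \<le> dist c x + dist c y" by (metis dist_commute dist_triangle2)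
    then have "y \<notin> ball c (1 / real (Suc m))" using c(2) m by auto
    moreover have "ball c (1 / real (Suc m)) \<in> \<U>" unfolding \<U>_def using c(1) by blast
    ultimately show ?thesis
      using from_nat_into_surj[OF cnt] c(2) by metis
  qed
  with op show ?thesis using that by blast
qed

section \<open>Increments of the truncated norm\<close>

definition marked :: "'i set \<Rightarrow> 'a::topological_space measure \<Rightarrow> ('i \<times> 'a) measure" where
  "marked I \<nu> = measure_pmf (pmf_of_set I) \<Otimes>\<^sub>M scale_measure (ennreal (1 / measure \<nu> UNIV)) \<nu>"

context
  fixes I :: "'i set" and \<nu> :: "'a::topological_space measure"
  assumes I: "finite I" "I \<noteq> {}" and sets_\<nu>: "sets \<nu> = sets borel"
    and fin: "emeasure \<nu> UNIV < \<infinity>" and pos: "measure \<nu> UNIV > 0"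
begin

lemma space_intensity: "space \<nu> = UNIV"
  using sets_eq_imp_space_eq[OF sets_\<nu>] by simp

lemma prob_space_normalized: "prob_space (scale_measure (ennreal (1 / measure \<nu> UNIV)) \<nu>)"
proof
  have "emeasure \<nu> UNIV = ennreal (measure \<nu> UNIV)"
    using fin by (intro emeasure_eq_ennreal_measure) auto
  then show "emeasure (scale_measure (ennreal (1 / measure \<nu> UNIV)) \<nu>)
      (space (scale_measure (ennreal (1 / measure \<nu> UNIV)) \<nu>)) = 1"
    using pos by (simp add: space_scale_measure space_intensity ennreal_mult[symmetric])
qed

lemma point_source_marked: "point_source (marked I \<nu>)"
proof -
  interpret N: prob_space "scale_measure (ennreal (1 / measure \<nu> UNIV)) \<nu>"
    by (rule prob_space_normalized)
  interpret M: prob_space "measure_pmf (pmf_of_set I)" by (rule prob_space_measure_pmf)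
  interpret pair_prob_space "measure_pmf (pmf_of_set I)" "scale_measure (ennreal (1 / measure \<nu> UNIV)) \<nu>" ..
  show ?thesis
    unfolding marked_def
    by (intro point_source.intro point_source_axioms.intro P.prob_space_axioms)
      (simp add: space_pair_measure space_scale_measure space_intensity)
qed

lemma sets_marked: "sets (marked I \<nu>) = sets (count_space UNIV \<Otimes>\<^sub>M borel)"
  unfolding marked_def by (intro sets_pair_measure_cong) (simp_all add: sets_\<nu>)

lemma nn_integral_marked:
  assumes "f \<in> borel_measurable (count_space UNIV \<Otimes>\<^sub>M borel)"
  shows "(\<integral>\<^sup>+z. f z \<partial>marked I \<nu>)
    = (\<Sum>i\<in>I. ennreal (1 / measure \<nu> UNIV) * (\<integral>\<^sup>+y. f (i, y) \<partial>\<nu>)) / ennreal (card I)"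
proof -
  interpret N: prob_space "scale_measure (ennreal (1 / measure \<nu> UNIV)) \<nu>"
    by (rule prob_space_normalized)
  have f: "f \<in> borel_measurable (marked I \<nu>)"
    using assms by (simp add: measurable_cong_sets[OF sets_marked refl])
  have fi: "(\<lambda>y. f (i, y)) \<in> borel_measurable \<nu>" for i
    using measurable_compose[OF measurable_Pair1'[of i "count_space UNIV" borel] assms]
    by (simp add: measurable_cong_sets[OF sets_\<nu> refl])
  have "(\<integral>\<^sup>+z. f z \<partial>marked I \<nu>)
      = (\<integral>\<^sup>+i. (\<integral>\<^sup>+y. f (i, y) \<partial>scale_measure (ennreal (1 / measure \<nu> UNIV)) \<nu>) \<partial>measure_pmf (pmf_of_set I))"
    using N.nn_integral_fst[OF f[unfolded marked_def]] by (simp add: marked_def)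
  also have "\<dots> = (\<Sum>i\<in>I. ennreal (1 / measure \<nu> UNIV) * (\<integral>\<^sup>+y. f (i, y) \<partial>\<nu>)) / ennreal (card I)"
    using I by (simp add: nn_integral_pmf_of_set nn_integral_scale_measure[OF fi] ennreal_of_nat_eq_real_of_nat)
  finally show ?thesis .
qed

text \<open>Multiplying by the total mass undoes the normalisation and returns one copy of
  \<open>\<nu>\<close> per mark; this is the hypothesis \<open>mass\<close> of
  \<open>poisson_product_eq_distr\<close>.\<close>

lemma measure_marked_Sigma:
  assumes "\<And>i. i \<in> I \<Longrightarrow> B i \<in> sets borel"
  shows "real (card I) * measure \<nu> UNIV * measure (marked I \<nu>) (Sigma I B) = (\<Sum>i\<in>I. measure \<nu> (B i))"
proof -
  have S: "Sigma I B \<in> sets (count_space UNIV \<Otimes>\<^sub>M borel)"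
  proof -
    have "Sigma I B = (\<Union>i\<in>I. {i} \<times> B i)" by blast
    also have "\<dots> \<in> sets (count_space UNIV \<Otimes>\<^sub>M borel)"
      using assms I(1) by (intro sets.finite_UN pair_measureI) auto
    finally show ?thesis .
  qed
  have em: "emeasure \<nu> (B i) = ennreal (measure \<nu> (B i))" for i
  proof (intro emeasure_eq_ennreal_measure)
    show "emeasure \<nu> (B i) \<noteq> \<top>"
      using le_less_trans[OF emeasure_mono[of "B i" UNIV \<nu>] fin] sets_\<nu> by simp
  qed
  have c: "real (card I) > 0" using I by (simp add: card_gt_0_iff)
  have "emeasure (marked I \<nu>) (Sigma I B) = (\<integral>\<^sup>+z. indicator (Sigma I B) z \<partial>marked I \<nu>)"
    using S by (simp add: sets_marked)
  also have "\<dots> = (\<Sum>i\<in>I. ennreal (1 / measure \<nu> UNIV) * (\<integral>\<^sup>+y. indicator (Sigma I B) (i, y) \<partial>\<nu>)) / ennreal (card I)"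
    using S by (intro nn_integral_marked) simp
  also have "(\<Sum>i\<in>I. ennreal (1 / measure \<nu> UNIV) * (\<integral>\<^sup>+y. indicator (Sigma I B) (i, y) \<partial>\<nu>))
      = (\<Sum>i\<in>I. ennreal (1 / measure \<nu> UNIV * measure \<nu> (B i)))"
  proof (rule sum.cong[OF refl])
    fix i assume i: "i \<in> I"
    have "(\<integral>\<^sup>+y. indicator (Sigma I B) (i, y) \<partial>\<nu>) = (\<integral>\<^sup>+y. indicator (B i) y \<partial>\<nu>)"
      using i by (intro nn_integral_cong) (simp add: indicator_def)
    also have "\<dots> = ennreal (measure \<nu> (B i))"
      using assms[OF i] em by (simp add: sets_\<nu>)
    finally show "ennreal (1 / measure \<nu> UNIV) * (\<integral>\<^sup>+y. indicator (Sigma I B) (i, y) \<partial>\<nu>)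
        = ennreal (1 / measure \<nu> UNIV * measure \<nu> (B i))"
      using pos by (simp only: ennreal_mult[symmetric] measure_nonneg divide_nonneg_nonneg zero_le_one)
  qed
  also have "\<dots> / ennreal (card I) = ennreal ((\<Sum>i\<in>I. 1 / measure \<nu> UNIV * measure \<nu> (B i)) / card I)"
    using c pos by (subst sum_ennreal) (auto intro!: divide_ennreal sum_nonneg)
  finally have "measure (marked I \<nu>) (Sigma I B) = (\<Sum>i\<in>I. 1 / measure \<nu> UNIV * measure \<nu> (B i)) / card I"
    using pos by (intro measure_eq_emeasure_eq_ennreal divide_nonneg_nonneg sum_nonneg) auto
  then show ?thesis
    using c pos by (simp add: sum_divide_distrib[symmetric])
qed

text \<open>The weights \<open>b i\<close> carry the current configuration and \<open>g\<close> the
  location of the added point, so the two separate. Passing through the nonnegative integral avoids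
  a separate integrability argument for \<open>f\<close>.\<close>

lemma integral_marked_le:
  fixes f :: "'i \<times> 'a \<Rightarrow> real" and g :: "'a \<Rightarrow> real"
  assumes "integrable \<nu> g" "\<And>y. g y \<ge> 0" "\<And>i. i \<in> I \<Longrightarrow> b i \<ge> 0"
    and f: "f \<in> borel_measurable (count_space UNIV \<Otimes>\<^sub>M borel)"
      "\<And>i y. i \<in> I \<Longrightarrow> f (i, y) \<le> b i * g y"
  shows "(\<integral>z. f z \<partial>marked I \<nu>) \<le> (\<Sum>i\<in>I. b i) * (\<integral>y. g y \<partial>\<nu>) / (real (card I) * measure \<nu> UNIV)"
proof (rule integral_real_bounded)
  have c: "real (card I) > 0" using I by (simp add: card_gt_0_iff)
  have J: "(\<integral>y. g y \<partial>\<nu>) \<ge> 0" using assms(2) by simp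
  show "(\<Sum>i\<in>I. b i) * (\<integral>y. g y \<partial>\<nu>) / (real (card I) * measure \<nu> UNIV) \<ge> 0"
    using J assms(3) pos by (intro divide_nonneg_nonneg mult_nonneg_nonneg sum_nonneg) auto
  have "(\<integral>\<^sup>+z. ennreal (f z) \<partial>marked I \<nu>)
      = (\<Sum>i\<in>I. ennreal (1 / measure \<nu> UNIV) * (\<integral>\<^sup>+y. ennreal (f (i, y)) \<partial>\<nu>)) / ennreal (card I)"
    using f(1) by (intro nn_integral_marked) simp
  also have "\<dots> \<le> (\<Sum>i\<in>I. ennreal (1 / measure \<nu> UNIV * (b i * (\<integral>y. g y \<partial>\<nu>)))) / ennreal (card I)"
  proof (intro divide_right_mono_ennreal sum_mono)
    fix i assume i: "i \<in> I"
    have "(\<integral>\<^sup>+y. ennreal (f (i, y)) \<partial>\<nu>) \<le> (\<integral>\<^sup>+y. ennreal (b i * g y) \<partial>\<nu>)"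
      using f(2)[OF i] by (intro nn_integral_mono ennreal_leI)
    also have "\<dots> = ennreal (\<integral>y. b i * g y \<partial>\<nu>)"
      using assms(1,2) assms(3)[OF i] by (intro nn_integral_eq_integral) auto
    also have "(\<integral>y. b i * g y \<partial>\<nu>) = b i * (\<integral>y. g y \<partial>\<nu>)" by simp
    finally have "ennreal (1 / measure \<nu> UNIV) * (\<integral>\<^sup>+y. ennreal (f (i, y)) \<partial>\<nu>)
        \<le> ennreal (1 / measure \<nu> UNIV) * ennreal (b i * (\<integral>y. g y \<partial>\<nu>))"
      by (rule mult_left_mono) simp
    also have "\<dots> = ennreal (1 / measure \<nu> UNIV * (b i * (\<integral>y. g y \<partial>\<nu>)))"
      using pos J assms(3)[OF i] by (intro ennreal_mult[symmetric]) auto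
    finally show "ennreal (1 / measure \<nu> UNIV) * (\<integral>\<^sup>+y. ennreal (f (i, y)) \<partial>\<nu>)
        \<le> ennreal (1 / measure \<nu> UNIV * (b i * (\<integral>y. g y \<partial>\<nu>)))" .
  qed
  also have "\<dots> = ennreal ((\<Sum>i\<in>I. 1 / measure \<nu> UNIV * (b i * (\<integral>y. g y \<partial>\<nu>))) / card I)"
    using c pos J assms(3) by (subst sum_ennreal) (auto intro!: divide_ennreal sum_nonneg)
  also have "(\<Sum>i\<in>I. 1 / measure \<nu> UNIV * (b i * (\<integral>y. g y \<partial>\<nu>))) / card I
      = (\<Sum>i\<in>I. b i) * (\<integral>y. g y \<partial>\<nu>) / (real (card I) * measure \<nu> UNIV)"
    by (simp add: sum_divide_distrib[symmetric] sum_distrib_right[symmetric] mult_ac)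
  finally show "(\<integral>\<^sup>+z. ennreal (f z) \<partial>marked I \<nu>)
      \<le> ennreal ((\<Sum>i\<in>I. b i) * (\<integral>y. g y \<partial>\<nu>) / (real (card I) * measure \<nu> UNIV))" .
qed

end

section \<open>Changing one coordinate of the Euclidean norm, and the Chernoff exponent\<close>

lemma L2_set_update_diff_le:
  assumes "finite I" "i \<in> I" "\<And>j. j \<in> I \<Longrightarrow> j \<noteq> i \<Longrightarrow> f' j = f j"
  shows "\<bar>L2_set f' I - L2_set f I\<bar> \<le> \<bar>f' i - f i\<bar>"
proof -
  have single: "L2_set (\<lambda>j. if j = i then c else 0) I = \<bar>c\<bar>" for c
    unfolding L2_set_def using assms(1,2) by (simp add: if_distrib[of "\<lambda>x. x\<^sup>2"] cong: if_cong)
  have "L2_set f' I = L2_set (\<lambda>j. f j + (if j = i then f' i - f i else 0)) I"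
    using assms(3) by (intro L2_set_cong) auto
  also have "\<dots> \<le> L2_set f I + L2_set (\<lambda>j. if j = i then f' i - f i else 0) I"
    by (rule L2_set_triangle_ineq)
  finally have 1: "L2_set f' I \<le> L2_set f I + \<bar>f' i - f i\<bar>" by (simp only: single)
  have "L2_set f I = L2_set (\<lambda>j. f' j + (if j = i then f i - f' i else 0)) I"
    using assms(3) by (intro L2_set_cong) auto
  also have "\<dots> \<le> L2_set f' I + L2_set (\<lambda>j. if j = i then f i - f' i else 0) I"
    by (rule L2_set_triangle_ineq)
  finally have "L2_set f I \<le> L2_set f' I + \<bar>f i - f' i\<bar>" by (simp only: single)
  with 1 show ?thesis by linarith
qed

text \<open>Truncating the norm from below at \<^term>\<open>m\<close> keeps the denominator
  away from zero, while the numerator \<^term>\<open>2 * f i * d + d\<^sup>2\<close> is what makes the sum over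
  \<^term>\<open>i\<close> free of the dimension.\<close>

lemma max_L2_set_update_square_le:
  assumes "finite I" "i \<in> I" "\<And>j. j \<in> I \<Longrightarrow> j \<noteq> i \<Longrightarrow> f' j = f j" "\<bar>f' i - f i\<bar> \<le> \<delta>" "m > 0"
  shows "(max (L2_set f' I) m - max (L2_set f I) m)\<^sup>2
    \<le> (8 * (f i)\<^sup>2 * \<delta>\<^sup>2 + 2 * \<delta> ^ 4) / (max (L2_set f I) m + m)\<^sup>2"
proof -
  define N N' d where "N = L2_set f I" and "N' = L2_set f' I" and "d = f' i - f i"
  define M M' where "M = max N m" and "M' = max N' m"
  have nn: "N \<ge> 0" "N' \<ge> 0" unfolding N_def N'_def by (simp_all add: L2_set_nonneg)
  have sq: "N'\<^sup>2 - N\<^sup>2 = 2 * f i * d + d\<^sup>2"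
  proof -
    have "N\<^sup>2 = (\<Sum>j\<in>I. (f j)\<^sup>2)" "N'\<^sup>2 = (\<Sum>j\<in>I. (f' j)\<^sup>2)"
      unfolding N_def N'_def L2_set_def by (simp_all add: sum_nonneg)
    then have "N'\<^sup>2 - N\<^sup>2 = (\<Sum>j\<in>I. (f' j)\<^sup>2 - (f j)\<^sup>2)" by (simp add: sum_subtractf)
    also have "\<dots> = (\<Sum>j\<in>I. if j = i then (f' i)\<^sup>2 - (f i)\<^sup>2 else 0)"
      using assms(3) by (intro sum.cong) auto
    also have "\<dots> = (f' i)\<^sup>2 - (f i)\<^sup>2" using assms(1,2) by simp
    finally show ?thesis by (simp add: d_def power2_eq_square algebra_simps)
  qed
  have max_sq: "(max a m)\<^sup>2 = max (a\<^sup>2) (m\<^sup>2)" if "a \<ge> 0" for a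
    using that assms(5) by (simp add: max_def power_mono_iff)
  \<comment> \<open>Since M' >= m, the denominator can be M + m, which does not depend on the new
    point and may leave the integral over it.\<close>
  have "\<bar>M' - M\<bar> * (M + m) \<le> \<bar>M' - M\<bar> * (M' + M)"
    unfolding M_def M'_def by (intro mult_left_mono) auto
  also have "\<dots> = \<bar>(M' - M) * (M' + M)\<bar>"
    using assms(5) by (simp add: abs_mult M_def M'_def)
  also have "(M' - M) * (M' + M) = M'\<^sup>2 - M\<^sup>2" by (simp add: power2_eq_square algebra_simps)
  \<comment> \<open>On squares the truncation is r -> max r (m^2), which is 1-Lipschitz.\<close>
  also have "\<bar>M'\<^sup>2 - M\<^sup>2\<bar> \<le> \<bar>N'\<^sup>2 - N\<^sup>2\<bar>"
    unfolding M_def M'_def max_sq[OF nn(1)] max_sq[OF nn(2)] by (simp add: max_def)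
  finally have "\<bar>M' - M\<bar> * (M + m) \<le> \<bar>2 * f i * d + d\<^sup>2\<bar>" unfolding sq .
  then have "(\<bar>M' - M\<bar> * (M + m))\<^sup>2 \<le> \<bar>2 * f i * d + d\<^sup>2\<bar>\<^sup>2"
    using assms(5) by (intro power_mono) (auto simp: M_def)
  then have "(M' - M)\<^sup>2 * (M + m)\<^sup>2 \<le> (2 * f i * d + d\<^sup>2)\<^sup>2"
    by (simp add: power_mult_distrib)
  also have "\<dots> \<le> 2 * (2 * f i * d)\<^sup>2 + 2 * (d\<^sup>2)\<^sup>2"
    using zero_le_power2[of "2 * f i * d - d\<^sup>2"] by (simp add: power2_sum power2_diff)
  also have "\<dots> = 8 * (f i)\<^sup>2 * d\<^sup>2 + 2 * (d\<^sup>2)\<^sup>2"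
    by (simp add: power_mult_distrib)
  also have "\<dots> \<le> 8 * (f i)\<^sup>2 * \<delta>\<^sup>2 + 2 * (\<delta>\<^sup>2)\<^sup>2"
  proof -
    have "d\<^sup>2 \<le> \<delta>\<^sup>2" using power_mono[OF assms(4), of 2] by (simp add: d_def)
    then show ?thesis by (intro add_mono mult_left_mono power_mono[of "d\<^sup>2"]) simp_all
  qed
  also have "\<dots> = 8 * (f i)\<^sup>2 * \<delta>\<^sup>2 + 2 * \<delta> ^ 4" by simp
  finally have "(M' - M)\<^sup>2 * (M + m)\<^sup>2 \<le> 8 * (f i)\<^sup>2 * \<delta>\<^sup>2 + 2 * \<delta> ^ 4" .
  moreover have "(M + m)\<^sup>2 > 0"
    using assms(5) unfolding M_def by (intro zero_less_power) simp
  ultimately show ?thesis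
    unfolding M_def M'_def N_def N'_def by (simp add: pos_le_divide_eq)
qed

text \<open>\<open>s\<close> is the critical point of the exponent: its derivative vanishes when a
  (exp (s K) - 1) / K = x.\<close>

lemma chernoff_exponent:
  fixes a K x :: real
  assumes "a > 0" "K > 0" "x > 0"
  defines "s \<equiv> ln (1 + x * K / a) / K"
  shows "a * ((exp (s * K) - 1 - s * K) / K\<^sup>2) - s * x
    = x / K - (x / K + a / K\<^sup>2) * ln (1 + x * K / a)" and "s > 0"
proof -
  have p: "x * K / a > 0" using assms by simp
  show "s > 0" unfolding s_def using p assms by (intro divide_pos_pos ln_gt_zero) auto
  define l where "l = ln (1 + x * K / a)"
  have sK: "s * K = l" "s = l / K" using assms by (simp_all add: s_def l_def)
  have "exp l = 1 + x * K / a" unfolding l_def using p by simp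
  then show "a * ((exp (s * K) - 1 - s * K) / K\<^sup>2) - s * x
    = x / K - (x / K + a / K\<^sup>2) * ln (1 + x * K / a)"
    unfolding sK l_def[symmetric] using assms by (simp add: field_simps power2_eq_square)
qed

lemma lip_const_increment_le:
  assumes "lip_const f = ennreal \<beta>" "\<beta> \<ge> 0" "y \<noteq> 0" "\<omega> \<in> configurations"
  shows "\<bar>f (insert y \<omega>) - f \<omega>\<bar> \<le> \<beta> * norm y"
proof -
  have "(case (y, \<omega>) of (y, \<omega>) \<Rightarrow> ennreal (\<bar>add_point_diff y f \<omega>\<bar> / norm y)) \<le> lip_const f"
    unfolding lip_const_def using assms(3,4) by (intro SUP_upper) auto
  then have "ennreal (\<bar>add_point_diff y f \<omega>\<bar> / norm y) \<le> ennreal \<beta>"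
    by (simp add: assms(1))
  then have "\<bar>add_point_diff y f \<omega>\<bar> / norm y \<le> \<beta>"
    using assms(2) by simp
  then show ?thesis
    using assms(3) by (simp add: add_point_diff_def pos_divide_le_eq)
qed

section \<open>The deviation inequality\<close>

theorem corollary3p3:
  fixes \<nu> :: "'a::real_normed_vector measure"
    and Q :: "nat \<Rightarrow> 'a set measure"
    and P :: "(nat \<Rightarrow> 'a set) measure"
    and F :: "nat \<Rightarrow> 'a set \<Rightarrow> real"
    and n :: nat
    and R \<beta> x :: real
  assumes "n \<ge> 1" and "R > 0"
    and "radon \<nu>" and "diffuse \<nu>"
    and "measure_support \<nu> \<subseteq> cball 0 R"
    and "\<And>i. i \<in> {1..n} \<Longrightarrow> poisson_law \<nu> (Q i)"
    and "P = (\<Pi>\<^sub>M i\<in>{1..n}. Q i)"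
    and "\<And>i. i \<in> {1..n} \<Longrightarrow> F i \<in> borel_measurable config_space"
    and "\<And>i. i \<in> {1..n} \<Longrightarrow>
           distr P borel (\<lambda>\<omega>. F i (\<omega> i)) = distr P borel (\<lambda>\<omega>. F 1 (\<omega> 1))"
    and "\<beta> \<ge> 0"
    and "\<And>i. i \<in> {1..n} \<Longrightarrow> lip_const (F i) = ennreal \<beta>"
    and "x > 0"
  shows "let normF = (\<lambda>\<omega>. L2_set (\<lambda>i. F i (\<omega> i)) {1..n});
             \<alpha>2 = (8 * \<beta>\<^sup>2 + 2 * \<beta> ^ 4 * R\<^sup>2 / (\<integral>\<omega>. \<bar>F 1 (\<omega> 1)\<bar> \<partial>P)\<^sup>2)
                    * (\<integral>y. (norm y)\<^sup>2 \<partial>\<nu>)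
         in measure P {\<omega> \<in> space P. normF \<omega> \<ge> x + 2 * (\<integral>\<omega>. normF \<omega> \<partial>P)}
              \<le> exp (x / (\<beta> * R)
                     - (x / (\<beta> * R) + \<alpha>2 / (\<beta>\<^sup>2 * R\<^sup>2)) * ln (1 + x * \<beta> * R / \<alpha>2))"
proof -
  let ?I = "{1..n}"
  define N where "N = (\<lambda>\<omega>. L2_set (\<lambda>i. F i (\<omega> i)) ?I)"
  define m1 where "m1 = (\<integral>\<omega>. \<bar>F 1 (\<omega> 1)\<bar> \<partial>P)"
  define J where "J = (\<integral>y. (norm y)\<^sup>2 \<partial>\<nu>)"
  define a where "a = (8 * \<beta>\<^sup>2 + 2 * \<beta> ^ 4 * R\<^sup>2 / m1\<^sup>2) * J"
  define m where "m = (\<integral>\<omega>. N \<omega> \<partial>P)"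
  define K where "K = \<beta> * R"
  have prob_P: "prob_space P"
    unfolding assms(7) using assms(6) by (intro prob_space_PiM) (simp add: poisson_law_def)
  interpret P: prob_space P by (rule prob_P)
  have J0: "J \<ge> 0" unfolding J_def by simp
  have goal: "measure P {\<omega> \<in> space P. N \<omega> \<ge> x + 2 * m}
      \<le> exp (x / K - (x / K + a / K\<^sup>2) * ln (1 + x * K / a))"
  proof (cases "a = 0")
    case True
    \<comment> \<open>Division by zero yields 0 and ln 1 = 0, so the claimed bound is exp (x / K) >=
      1. This covers \<beta> = 0 and a second moment integral equal to 0.\<close>
    have "x / K \<ge> 0" unfolding K_def using assms(2,10,12) by simp
    then have "exp (x / K - (x / K + a / K\<^sup>2) * ln (1 + x * K / a)) \<ge> 1"
      using True by simp
    then show ?thesis using P.prob_le_1 order_trans by blast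
  next
    case False
    have "\<beta> \<noteq> 0" and "J \<noteq> 0" using False unfolding a_def by auto
    then have "\<beta> > 0" "J > 0" using assms(10) J0 by simp_all
    have "a \<ge> 0" unfolding a_def using J0 by simp
    then have "a > 0" using False by simp
    have "K > 0" unfolding K_def using \<open>\<beta> > 0\<close> assms(2) by simp
    note radon = assms(3)
    note sets_\<nu> = radon_sets[OF radon]
    have space_\<nu>: "space \<nu> = UNIV" using sets_eq_imp_space_eq[OF sets_\<nu>] by simp
    \<comment> \<open>The Bochner integral of a non-integrable function is 0, so J nonzero certifies
      integrability.\<close>
    have int2: "integrable \<nu> (\<lambda>y. (norm y)\<^sup>2)"
      using \<open>J \<noteq> 0\<close> not_integrable_integral_eq unfolding J_def by blast
    have fin: "emeasure \<nu> UNIV < \<infinity>"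
      by (rule radon_finite_of_second_moment[OF radon int2])
    define l where "l = measure \<nu> UNIV"
    have "l > 0"
    proof (rule ccontr)
      assume "\<not> l > 0"
      then have "l = 0" using measure_nonneg[of \<nu> UNIV] by (simp add: l_def)
      then have "emeasure \<nu> (space \<nu>) = 0"
        using fin by (auto simp: l_def measure_def space_\<nu> enn2real_eq_0_iff)
      then have "AE y in \<nu>. (norm y)\<^sup>2 = 0"
        by (intro AE_I[of _ _ "space \<nu>"]) auto
      then have "J = 0" unfolding J_def by (rule integral_eq_zero_AE)
      then show False using \<open>J \<noteq> 0\<close> by simp
    qed
    \<comment> \<open>The origin is removed because \<open>lip_const\<close> gives no bound for
      inserting 0.\<close>
    define B where "B = cball (0::'a) R - {0}"
    have B: "B \<in> sets borel" unfolding B_def by measurable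
    have Bfin: "emeasure \<nu> B < \<infinity>"
      using le_less_trans[OF emeasure_mono[of B UNIV \<nu>] fin] sets_\<nu> by simp
    obtain C :: "nat \<Rightarrow> 'a set" where C: "\<And>k. compact (C k)" "(\<Union>k. C k) \<subseteq> B" "emeasure \<nu> (B - (\<Union>k. C k)) = 0"
      using radon_sigma_compact[OF radon B Bfin] by metis
    define S where "S = (\<Union>k. C k)"
    have S: "S \<in> sets borel"
      unfolding S_def using C(1) by (intro sets.countable_UN'') (auto intro: borel_closed compact_imp_closed)
    have "emeasure \<nu> (- cball 0 R) = 0"
      by (rule radon_null_outside_support[OF radon assms(5)]) simp
    moreover have "emeasure \<nu> {0} = 0" using assms(4) by (simp add: diffuse_def)
    moreover have "B - S \<in> null_sets \<nu>"
      using C(3) B S by (simp add: null_sets_def sets_\<nu> S_def)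
    ultimately have Z: "- cball 0 R \<union> {0} \<union> (B - S) \<in> null_sets \<nu>"
      by (intro null_sets.Un) (simp_all add: null_sets_def sets_\<nu>)
    have "- S \<subseteq> - cball 0 R \<union> {0} \<union> (B - S)" unfolding B_def by blast
    then have "emeasure \<nu> (- S) \<le> emeasure \<nu> (- cball 0 R \<union> {0} \<union> (B - S))"
      using Z by (intro emeasure_mono) auto
    then have S0: "emeasure \<nu> (- S) = 0"
      using Z by (simp add: null_sets_def)
    obtain U :: "nat \<Rightarrow> 'a set" where U: "\<And>k. open (U k)"
      "\<And>x y. x \<in> S \<Longrightarrow> x \<noteq> y \<Longrightarrow> \<exists>k. x \<in> U k \<and> y \<notin> U k"
      by (rule sigma_compact_separating[of C, OF C(1), folded S_def]) blast
    have I: "finite ?I" "?I \<noteq> {}" using assms(1) by auto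
    define \<Lambda> where "\<Lambda> = real n * l"
    have "\<Lambda> > 0" unfolding \<Lambda>_def using assms(1) \<open>l > 0\<close> by simp
    let ?\<mu> = "marked ?I \<nu>"
    note marked = I sets_\<nu> fin \<open>l > 0\<close>[unfolded l_def]
    interpret point_source ?\<mu> by (rule point_source_marked[OF marked])
    note sets_\<mu> = sets_marked[OF marked]
    let ?C = "PiM ?I (\<lambda>_. config_space :: 'a set measure)"
    \<comment> \<open>\<open>E\<close> pulls functionals of tuples back to finite sets of marked
      points. A point located outside \<open>S\<close> is ignored, so the increment bounds hold for
      every added point, as \<open>lip\<close> demands, and not just almost everywhere.\<close>
    define E where "E \<xi> = confine S ?I (unmark ?I \<xi>)" for \<xi> :: "(nat \<times> 'a) set"
    have Ub: "U k \<in> sets borel" for k using U(1) by (rule borel_open)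
    have mass: "\<Lambda> * measure ?\<mu> (Sigma ?I B) = (\<Sum>i\<in>?I. measure \<nu> (B i))"
      if "\<And>i. i \<in> ?I \<Longrightarrow> B i \<in> sets borel" for B
      using measure_marked_Sigma[OF marked that] by (simp add: \<Lambda>_def l_def)
    note law = poisson_product_eq_distr[where Q = Q and U = U, OF point_source_axioms sets_\<mu> I \<open>\<Lambda> > 0\<close> assms(6) fin sets_\<nu> S S0 Ub U(2) mass,
        folded E_def]
    have P_eq: "P = distr (poisson_seq \<Lambda>) ?C (\<lambda>(k, X). E (set (stake k X)))"
      unfolding assms(7) by (rule law(1))
    have E_meas: "(\<lambda>(k, X). E (set (stake k X))) \<in> measurable (poisson_seq \<Lambda>) ?C"
      by (rule law(2))
    have E_k: "(\<lambda>X. E (set (stake k X))) \<in> measurable (stream_space ?\<mu>) ?C" for k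
    proof -
      have "(\<lambda>X. (k, X)) \<in> measurable (stream_space ?\<mu>) (poisson_seq \<Lambda>)"
        unfolding poisson_seq_def by (rule measurable_Pair1') simp
      from measurable_compose[OF this E_meas] show ?thesis by simp
    qed
    have E_insert: "E (insert (i, y) \<xi>) = (if i \<in> ?I \<and> y \<in> S then (E \<xi>)(i := insert y (E \<xi> i)) else E \<xi>)" for i y \<xi>
      unfolding E_def confine_def unmark_def by (auto simp: fun_eq_iff restrict_def)
    have E_conf: "E \<xi> i \<in> configurations" if "finite \<xi>" "i \<in> ?I" for \<xi> i
    proof -
      have "unmark ?I \<xi> i \<in> configurations"
        using unmark_configurations[OF that(1), of ?I] that(2) by (rule PiE_mem)
      then show ?thesis
        using that(2) configurations_Int by (simp add: E_def confine_def)
    qed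
    have F_inc: "\<bar>F i (insert y (E \<xi> i)) - F i (E \<xi> i)\<bar> \<le> \<beta> * norm y" "norm y \<le> R"
      if "i \<in> ?I" "y \<in> S" "finite \<xi>" for i y \<xi>
    proof -
      have "y \<in> B" using that(2) C(2) unfolding S_def by blast
      then have y: "y \<noteq> 0" "norm y \<le> R" unfolding B_def by (auto simp: dist_norm)
      show "norm y \<le> R" by (rule y(2))
      show "\<bar>F i (insert y (E \<xi> i)) - F i (E \<xi> i)\<bar> \<le> \<beta> * norm y"
        by (rule lip_const_increment_le[OF assms(11)[OF that(1)] assms(10) y(1) E_conf[OF that(3,1)]])
    qed
    have F_inc_K: "\<bar>F i (insert y (E \<xi> i)) - F i (E \<xi> i)\<bar> \<le> K" if "i \<in> ?I" "y \<in> S" "finite \<xi>" for i y \<xi>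
      using F_inc(1)[OF that] mult_left_mono[OF F_inc(2)[OF that] assms(10)] unfolding K_def by linarith
    have Fi_C: "(\<lambda>\<omega>. F i (\<omega> i)) \<in> borel_measurable ?C" if "i \<in> ?I" for i
      using measurable_compose[OF measurable_component_singleton[OF that] assms(8)[OF that]] .
    have N_C: "N \<in> borel_measurable ?C"
      unfolding N_def L2_set_def using Fi_C by measurable
    have N_inc: "\<bar>N (E (insert z \<xi>)) - N (E \<xi>)\<bar> \<le> K" if "finite \<xi>" for \<xi> z
    proof -
      obtain i y where z: "z = (i, y)" by (cases z)
      show ?thesis
      proof (cases "i \<in> ?I \<and> y \<in> S")
        case True
        define \<omega> where "\<omega> = E \<xi>"
        define \<omega>' where "\<omega>' = fun_upd \<omega> i (insert y (\<omega> i))"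
        have "E (insert z \<xi>) = \<omega>'"
          using E_insert[of i y \<xi>] True by (simp add: \<omega>_def \<omega>'_def z)
        moreover have "\<bar>L2_set (\<lambda>i. F i (\<omega>' i)) ?I - L2_set (\<lambda>i. F i (\<omega> i)) ?I\<bar>
            \<le> \<bar>F i (\<omega>' i) - F i (\<omega> i)\<bar>"
          using True by (intro L2_set_update_diff_le) (auto simp: \<omega>'_def)
        ultimately show ?thesis
          using F_inc_K[OF conjunct1[OF True] conjunct2[OF True] that] by (simp add: N_def \<omega>_def \<omega>'_def)
      next
        case False
        then have "E (insert z \<xi>) = E \<xi>" using E_insert[of i y \<xi>] by (auto simp: z)
        then show ?thesis using \<open>K > 0\<close> by simp
      qed
    qed
    have tame_comp: "tame (\<lambda>\<xi>. g (E \<xi>))"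
      if "g \<in> borel_measurable ?C" "\<And>\<xi> z. finite \<xi> \<Longrightarrow> \<bar>g (E (insert z \<xi>)) - g (E \<xi>)\<bar> \<le> K" for g
      using that by (intro tame_of_increments[where K = K] measurable_compose[OF E_k that(1)]) auto
    have transfer: "integrable P g" "(\<integral>\<omega>. g \<omega> \<partial>P) = (\<integral>(k, X). g (E (set (stake k X))) \<partial>poisson_seq \<Lambda>)"
      if "g \<in> borel_measurable ?C" "tame (\<lambda>\<xi>. g (E \<xi>))" for g :: "(nat \<Rightarrow> 'a set) \<Rightarrow> real"
    proof -
      show "integrable P g"
        unfolding P_eq using poisson_seq_tame(1)[OF \<open>\<Lambda> > 0\<close> that(2)]
        by (subst integrable_distr_eq[OF E_meas that(1)]) (simp add: case_prod_unfold)
      show "(\<integral>\<omega>. g \<omega> \<partial>P) = (\<integral>(k, X). g (E (set (stake k X))) \<partial>poisson_seq \<Lambda>)"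
        unfolding P_eq by (subst integral_distr[OF E_meas that(1)]) (simp add: case_prod_unfold)
    qed
    have sets_P: "sets P = sets ?C" by (simp add: P_eq)
    have tame_F: "tame (\<lambda>\<xi>. F i (E \<xi> i))" if i: "i \<in> ?I" for i
    proof (rule tame_comp[OF Fi_C[OF i]])
      fix \<xi> :: "(nat \<times> 'a) set" and z assume fx: "finite \<xi>"
      show "\<bar>F i (E (insert z \<xi>) i) - F i (E \<xi> i)\<bar> \<le> K"
        using E_insert[of "fst z" "snd z" \<xi>] F_inc_K[OF i _ fx, of "snd z"] \<open>K > 0\<close>
        by (cases "fst z = i") auto
    qed
    \<comment> \<open>Integrability comes from the Lipschitz condition: bounded increments make the
      functionals tame.\<close>
    have int_F: "integrable P (\<lambda>\<omega>. \<bar>F i (\<omega> i)\<bar>)" if "i \<in> ?I" for i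
      using transfer(1)[OF Fi_C tame_F] that by (intro integrable_abs) auto
    have int_N: "integrable P N"
      by (rule transfer(1)[OF N_C tame_comp[OF N_C N_inc]])
    have EF: "(\<integral>\<omega>. \<bar>F i (\<omega> i)\<bar> \<partial>P) = m1" if i: "i \<in> ?I" for i
    proof -
      have 1: "1 \<in> ?I" using assms(1) by simp
      have meas: "(\<lambda>\<omega>. F j (\<omega> j)) \<in> borel_measurable P" if "j \<in> ?I" for j
        using Fi_C[OF that] by (simp add: measurable_cong_sets[OF sets_P refl])
      have "(\<integral>\<omega>. \<bar>F i (\<omega> i)\<bar> \<partial>P) = (\<integral>r. \<bar>r\<bar> \<partial>distr P borel (\<lambda>\<omega>. F i (\<omega> i)))"
        by (rule integral_distr[OF meas[OF i], symmetric]) simp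
      also have "\<dots> = (\<integral>\<omega>. \<bar>F 1 (\<omega> 1)\<bar> \<partial>P)"
        unfolding assms(9)[OF i] by (rule integral_distr[OF meas[OF 1]]) simp
      finally show ?thesis by (simp add: m1_def)
    qed
    have N0: "N \<omega> \<ge> 0" for \<omega> unfolding N_def by (rule L2_set_nonneg)
    have m1_0: "m1 \<ge> 0" unfolding m1_def by simp
    show ?thesis
    proof (cases "m1 = 0")
      case True
      \<comment> \<open>With m1 = 0 the quotient by m1^2 in \<open>a\<close> is 0 by convention, but
        all F_i vanish almost surely and x > 0 makes the event null.\<close>
      have "AE \<omega> in P. F i (\<omega> i) = 0" if "i \<in> ?I" for i
        using integral_nonneg_eq_0_iff_AE[OF int_F[OF that]] EF[OF that] True by simp
      then have "AE \<omega> in P. \<forall>i\<in>?I. F i (\<omega> i) = 0" by (intro AE_finite_allI) auto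
      then have AE0: "AE \<omega> in P. N \<omega> = 0"
        by eventually_elim (simp add: N_def L2_set_def)
      then have "m = 0" unfolding m_def by (rule integral_eq_zero_AE)
      have "AE \<omega> in P. \<not> N \<omega> \<ge> x + 2 * m"
        using AE0 by eventually_elim (use assms(12) \<open>m = 0\<close> in simp)
      then have "measure P {\<omega> \<in> space P. N \<omega> \<ge> x + 2 * m} = 0"
        by (intro P.prob_Collect_eq_0[THEN iffD2]) (use int_N in \<open>auto\<close>)
      then show ?thesis by simp
    next
      case False
      then have "m1 > 0" using m1_0 by simp
      \<comment> \<open>Cauchy-Schwarz against the vector of ones; its expectation is m >= sqrt n *
        m1, which later cancels the factor n in the fourth order term.\<close>
      have CS: "(\<Sum>i\<in>?I. \<bar>F i (\<omega> i)\<bar>) \<le> sqrt n * N \<omega>" for \<omega>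
        using L2_set_mult_ineq[of "\<lambda>i. F i (\<omega> i)" "\<lambda>_. 1" ?I]
        by (simp add: L2_set_def N_def mult.commute)
      have "real n * m1 = (\<integral>\<omega>. (\<Sum>i\<in>?I. \<bar>F i (\<omega> i)\<bar>) \<partial>P)"
        using int_F EF by (subst Bochner_Integration.integral_sum) auto
      also have "\<dots> \<le> (\<integral>\<omega>. sqrt n * N \<omega> \<partial>P)"
        using int_F int_N CS by (intro integral_mono Bochner_Integration.integrable_sum integrable_mult_right) auto
      finally have "sqrt n * (sqrt n * m1) \<le> sqrt n * m" by (simp add: m_def mult.assoc[symmetric])
      then have m_ge: "sqrt n * m1 \<le> m" using assms(1) by simp
      have "m > 0"
        using less_le_trans[OF mult_pos_pos[of "sqrt n" m1] m_ge] \<open>m1 > 0\<close> assms(1) by simp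
      have m_sq: "real n * m1\<^sup>2 \<le> m\<^sup>2"
        using power_mono[OF m_ge, of 2] \<open>m1 > 0\<close> by (simp add: power_mult_distrib)
      define g where "g \<omega> = max (N \<omega>) m" for \<omega>
      have g_C: "g \<in> borel_measurable ?C" unfolding g_def using N_C by measurable
      have g_inc: "\<bar>g (E (insert z \<xi>)) - g (E \<xi>)\<bar> \<le> K" if "finite \<xi>" for \<xi> z
        using N_inc[OF that, of z] unfolding g_def by (auto simp: max_def)
      have tame_g: "tame (\<lambda>\<xi>. g (E \<xi>))" by (rule tame_comp[OF g_C g_inc])
      \<comment> \<open>The mean square jump under the normalised marked law is 1/\<Lambda> times
        the integral against the full intensity, so that \<open>\<Lambda> * v = a\<close>.\<close>
      define v where "v = a / \<Lambda>"
      have lip_g: "lip K v (\<lambda>\<xi>. g (E \<xi>))"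
        unfolding lip_def
      proof (intro conjI allI impI g_inc)
        fix \<xi> :: "(nat \<times> 'a) set" assume fx: "finite \<xi>"
        define \<omega> where "\<omega> = E \<xi>"
        define D where "D = (g \<omega> + m)\<^sup>2"
        have gm: "g \<omega> \<ge> N \<omega>" "g \<omega> \<ge> m" by (simp_all add: g_def)
        have "D \<ge> m\<^sup>2" "D \<ge> (N \<omega>)\<^sup>2"
          unfolding D_def using gm \<open>m > 0\<close> N0[of \<omega>] by (auto intro!: power_mono)
        have "D > 0" using \<open>D \<ge> m\<^sup>2\<close> \<open>m > 0\<close> by (meson less_le_trans zero_less_power)
        \<comment> \<open>The bound of \<open>max_L2_set_update_square_le\<close> with one factor
          (norm y)^2 taken out; the second such factor in the fourth order term is replaced by
          R^2.\<close>
        define b where "b i = (8 * (F i (\<omega> i))\<^sup>2 * \<beta>\<^sup>2 + 2 * \<beta> ^ 4 * R\<^sup>2) / D" for i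
        have b0: "b i \<ge> 0" for i unfolding b_def using \<open>D > 0\<close> by simp
        have meas: "(\<lambda>z. (g (E (insert z \<xi>)) - g (E \<xi>))\<^sup>2) \<in> borel_measurable (count_space UNIV \<Otimes>\<^sub>M borel)"
          using tameD_insert[OF tame_g fx] unfolding measurable_cong_sets[OF sets_\<mu> refl] by simp
        have bound: "(g (E (insert (i, y) \<xi>)) - g (E \<xi>))\<^sup>2 \<le> b i * (norm y)\<^sup>2" if i: "i \<in> ?I" for i y
        proof (cases "y \<in> S")
          case True
          let ?\<omega>' = "fun_upd \<omega> i (insert y (\<omega> i))"
          note inc = F_inc[OF i True fx, folded \<omega>_def]
          have e: "E (insert (i, y) \<xi>) = ?\<omega>'" using E_insert[of i y \<xi>] i True by (simp add: \<omega>_def)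
          have "(max (L2_set (\<lambda>j. F j (?\<omega>' j)) ?I) m - max (L2_set (\<lambda>j. F j (\<omega> j)) ?I) m)\<^sup>2
              \<le> (8 * (F i (\<omega> i))\<^sup>2 * (\<beta> * norm y)\<^sup>2 + 2 * (\<beta> * norm y) ^ 4) / (max (L2_set (\<lambda>j. F j (\<omega> j)) ?I) m + m)\<^sup>2"
            using i inc(1) \<open>m > 0\<close> by (intro max_L2_set_update_square_le) auto
          then have "(g (E (insert (i, y) \<xi>)) - g (E \<xi>))\<^sup>2
              \<le> (8 * (F i (\<omega> i))\<^sup>2 * (\<beta> * norm y)\<^sup>2 + 2 * (\<beta> * norm y) ^ 4) / D"
            unfolding e D_def g_def N_def \<omega>_def[symmetric] .
          also have "\<dots> \<le> (8 * (F i (\<omega> i))\<^sup>2 * \<beta>\<^sup>2 * (norm y)\<^sup>2 + 2 * \<beta> ^ 4 * R\<^sup>2 * (norm y)\<^sup>2) / D"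
          proof (intro divide_right_mono add_mono)
            have "(norm y)\<^sup>2 \<le> R\<^sup>2" using inc(2) by (intro power_mono) auto
            then have "2 * \<beta> ^ 4 * (norm y)\<^sup>2 * (norm y)\<^sup>2 \<le> 2 * \<beta> ^ 4 * R\<^sup>2 * (norm y)\<^sup>2"
              by (intro mult_right_mono mult_left_mono) auto
            then show "2 * (\<beta> * norm y) ^ 4 \<le> 2 * \<beta> ^ 4 * R\<^sup>2 * (norm y)\<^sup>2"
              by (simp add: power_mult_distrib power4_eq_xxxx power2_eq_square mult_ac)
          qed (use \<open>D > 0\<close> in \<open>simp_all add: power_mult_distrib\<close>)
          also have "\<dots> = b i * (norm y)\<^sup>2" by (simp add: b_def distrib_right)
          finally show ?thesis .
        next
          case False
          then show ?thesis using E_insert[of i y \<xi>] b0[of i] by simp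
        qed
        have "(\<integral>z. (g (E (insert z \<xi>)) - g (E \<xi>))\<^sup>2 \<partial>?\<mu>)
            \<le> (\<Sum>i\<in>?I. b i) * (\<integral>y. (norm y)\<^sup>2 \<partial>\<nu>) / (real (card ?I) * measure \<nu> UNIV)"
          using b0 bound by (intro integral_marked_le[OF marked int2 _ _ meas]) auto
        also have "\<dots> = (\<Sum>i\<in>?I. b i) * J / \<Lambda>" by (simp add: J_def \<Lambda>_def l_def)
        also have "\<dots> \<le> a / \<Lambda>"
        proof (intro divide_right_mono)
          have N2: "(N \<omega>)\<^sup>2 = (\<Sum>i\<in>?I. (F i (\<omega> i))\<^sup>2)" unfolding N_def L2_set_def by (simp add: sum_nonneg)
          have "(\<Sum>i\<in>?I. b i) = (8 * \<beta>\<^sup>2 * (N \<omega>)\<^sup>2 + 2 * \<beta> ^ 4 * R\<^sup>2 * real n) / D"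
            unfolding b_def N2 by (simp add: sum_divide_distrib[symmetric] sum.distrib sum_distrib_left mult_ac)
          also have "\<dots> = 8 * \<beta>\<^sup>2 * ((N \<omega>)\<^sup>2 / D) + 2 * \<beta> ^ 4 * R\<^sup>2 * (real n / D)"
            by (simp add: add_divide_distrib)
          also have "\<dots> \<le> 8 * \<beta>\<^sup>2 * 1 + 2 * \<beta> ^ 4 * R\<^sup>2 * (1 / m1\<^sup>2)"
          proof (intro add_mono mult_left_mono)
            show "(N \<omega>)\<^sup>2 / D \<le> 1" using \<open>D > 0\<close> \<open>D \<ge> (N \<omega>)\<^sup>2\<close> by simp
            have "real n * m1\<^sup>2 \<le> D" using m_sq \<open>D \<ge> m\<^sup>2\<close> by linarith
            then show "real n / D \<le> 1 / m1\<^sup>2" using \<open>D > 0\<close> \<open>m1 > 0\<close> by (simp add: field_simps)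
          qed auto
          finally have "(\<Sum>i\<in>?I. b i) \<le> 8 * \<beta>\<^sup>2 + 2 * \<beta> ^ 4 * R\<^sup>2 / m1\<^sup>2" by simp
          then show "(\<Sum>i\<in>?I. b i) * J \<le> a" unfolding a_def using J0 by (rule mult_right_mono)
        qed (use \<open>\<Lambda> > 0\<close> in simp)
        finally show "(\<integral>z. (g (E (insert z \<xi>)) - g (E \<xi>))\<^sup>2 \<partial>?\<mu>) \<le> v" unfolding v_def .
      qed
      define s where "s = ln (1 + x * K / a) / K"
      have "s > 0" unfolding s_def by (rule chernoff_exponent(2)[OF \<open>a > 0\<close> \<open>K > 0\<close> assms(12)])
      have eg_C: "(\<lambda>\<omega>. exp (s * g \<omega>)) \<in> borel_measurable ?C" using g_C by measurable
      have tame_eg: "tame (\<lambda>\<xi>. exp (s * g (E \<xi>)))"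
        using \<open>s > 0\<close> g_inc by (intro tame_exp[where K = K] measurable_compose[OF E_k g_C]) auto
      define e where "e = (\<integral>\<omega>. g \<omega> \<partial>P)"
      have int_g: "integrable P g" by (rule transfer(1)[OF g_C tame_g])
      have "e \<le> (\<integral>\<omega>. N \<omega> + m \<partial>P)"
        unfolding e_def using int_g int_N N0 \<open>m > 0\<close> by (intro integral_mono) (auto simp: g_def)
      also have "\<dots> = 2 * m" using int_N by (simp add: m_def P.prob_space)
      finally have e_le: "e \<le> 2 * m" .
      have mgf: "(\<integral>\<omega>. exp (s * g \<omega>) \<partial>P) \<le> exp (s * e + a * ((exp (s * K) - 1 - s * K) / K\<^sup>2))"
      proof -
        have "\<Lambda> * v = a" using \<open>\<Lambda> > 0\<close> by (simp add: v_def)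
        then show ?thesis
          using poisson_seq_exp_le[OF \<open>\<Lambda> > 0\<close> tame_g lip_g \<open>K > 0\<close> \<open>s > 0\<close>]
          by (simp only: e_def transfer(2)[OF eg_C tame_eg] transfer(2)[OF g_C tame_g])
      qed
      have "measure P {\<omega> \<in> space P. N \<omega> \<ge> x + 2 * m}
          \<le> measure P {\<omega> \<in> space P. exp (s * g \<omega>) \<ge> exp (s * (x + e))}"
      proof (intro P.finite_measure_mono)
        have "x + e \<le> g \<omega>" if "x + 2 * m \<le> N \<omega>" for \<omega> using that e_le by (simp add: g_def)
        then show "{\<omega> \<in> space P. N \<omega> \<ge> x + 2 * m} \<subseteq> {\<omega> \<in> space P. exp (s * g \<omega>) \<ge> exp (s * (x + e))}"
          using \<open>s > 0\<close> by auto
        have [measurable]: "g \<in> borel_measurable P" using int_g by simp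
        show "{\<omega> \<in> space P. exp (s * g \<omega>) \<ge> exp (s * (x + e))} \<in> sets P" by measurable
      qed
      also have "\<dots> \<le> (\<integral>\<omega>. exp (s * g \<omega>) \<partial>P) / exp (s * (x + e))"
        by (rule integral_Markov_inequality_measure[OF transfer(1)[OF eg_C tame_eg] sets.empty_sets]) auto
      also have "\<dots> \<le> exp (s * e + a * ((exp (s * K) - 1 - s * K) / K\<^sup>2)) / exp (s * (x + e))"
        using mgf by (rule divide_right_mono) simp
      also have "\<dots> = exp (a * ((exp (s * K) - 1 - s * K) / K\<^sup>2) - s * x)"
        by (simp add: exp_diff[symmetric] algebra_simps)
      also have "\<dots> = exp (x / K - (x / K + a / K\<^sup>2) * ln (1 + x * K / a))"
        unfolding s_def using chernoff_exponent(1)[OF \<open>a > 0\<close> \<open>K > 0\<close> assms(12)] by simp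
      finally show ?thesis .
    qed
  qed
  show ?thesis
    using goal unfolding Let_def m_def a_def m1_def J_def K_def N_def
    by (simp only: power_mult_distrib mult.assoc)
qed

end
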